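(* Let $1\le q_1<p<q_2$. Assume that (i) $X$ is an asymptotically $p$-uniformly smooth Banach space with the $p$-co-Banach-Saks property which does not contain $\ell_1$; (ii) $Y_1$ is a Banach space with a $1$-unconditional basis satisfying a lower $\ell_{q_1}$-estimate with constant $1$; and (iii) $Y_2$ is a reflexive asymptotically $q_2$-uniformly smooth Banach space. Then $X$ does not coarse Lipschitz embed into $Y_1\oplus Y_2$.
   Context: A space $Z$ is asymptotically $r$-uniformly smooth if $\overline\rho_Z(t)\le Ct^r$ on $[0,1]$ for some $C$, where $\overline{\rho}_Z(t)=\sup_{z\in\partial B_Z}\inf_{\dim(Z/E)<\infty}\sup_{h\in\partial B_E}\|z+th\|-1$. $X$ has the $p$-co-Banach-Saks property if every semi-normalized weakly null sequence $(x_n)$ has a subsequence $(x_{n_j})$ and $c>0$ with $\|x_{n_{j_1}}+\dots+x_{n_{j_k}}\|\ge ck^{1/p}$ for all $k\le j_1<\dots<j_k$. A $1$-unconditional basis satisfies a lower $\ell_q$-estimate with constant $1$ if $\|y_1+\dots+y_k\|^q\ge\sum\|y_n\|^q$ for disjointly supported $y_n$. A coarse Lipschitz embedding is a map $f$ with $\omega_f(t)\le Lt+L$ and $\rho_f(t)\ge L^{-1}t-L$ for some $L>0$, where $\omega_f(t)=\sup\{\|f(x)-f(y)\|:\|x-y\|\le t\}$, $\rho_f(t)=\inf\{\|f(x)-f(y)\|:\|x-y\|\ge t\}$.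
   Formalization: The formal theorem additionally assumes that X is infinite-dimensional; for finite-dimensional X the hypotheses hold vacuously and X embeds linearly into Y_1, so the statement as written fails. *)

theory Defs
  imports "HOL-Analysis.Analysis"
begin

definition infinite_dimensional :: "'a::real_normed_vector itself \<Rightarrow> bool" where
  "infinite_dimensional _ \<longleftrightarrow> \<not> (\<exists>B::'a set. finite B \<and> span B = UNIV)"

definition fin_codim_subspace :: "'a::real_normed_vector set \<Rightarrow> bool" where
  "fin_codim_subspace E \<longleftrightarrow> subspace E \<and> closed E \<and>
     (\<exists>F. finite F \<and> span (E \<union> F) = UNIV)"

text \<open>Modulus of asymptotic uniform smoothness (extended-real valued, so that
  suprema/infima are always defined).\<close>
definition asym_smooth_modulus :: "'a::real_normed_vector itself \<Rightarrow> real \<Rightarrow> ereal" where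
  "asym_smooth_modulus _ t =
     (SUP z\<in>{z::'a. norm z = 1}.
        (INF E\<in>{E::'a set. fin_codim_subspace E}.
           (SUP h\<in>{h\<in>E. norm h = 1}. ereal (norm (z + t *\<^sub>R h))))) - 1"

definition asymptotically_uniformly_smooth_power :: "'a::real_normed_vector itself \<Rightarrow> real \<Rightarrow> bool" where
  "asymptotically_uniformly_smooth_power Z r \<longleftrightarrow>
     (\<exists>C. \<forall>t\<in>{0..1}. asym_smooth_modulus Z t \<le> ereal (C * t powr r))"

definition weakly_null :: "(nat \<Rightarrow> 'a::real_normed_vector) \<Rightarrow> bool" where
  "weakly_null x \<longleftrightarrow> (\<forall>f::'a \<Rightarrow>\<^sub>L real. (\<lambda>n. blinfun_apply f (x n)) \<longlonglongrightarrow> 0)"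

definition semi_normalized :: "(nat \<Rightarrow> 'a::real_normed_vector) \<Rightarrow> bool" where
  "semi_normalized x \<longleftrightarrow> (\<exists>a b. 0 < a \<and> (\<forall>n. a \<le> norm (x n) \<and> norm (x n) \<le> b))"

text \<open>p-co-Banach-Saks property. The subsequence is (x (\<sigma> j)) for j \<ge> 1; a finite
  set F of indices j_1<...<j_k with k \<le> j_1 is any finite F with card F \<le> j for all j in F.\<close>
definition co_banach_saks :: "'a::real_normed_vector itself \<Rightarrow> real \<Rightarrow> bool" where
  "co_banach_saks _ p \<longleftrightarrow>
     (\<forall>x::nat \<Rightarrow> 'a. semi_normalized x \<and> weakly_null x \<longrightarrow>
        (\<exists>\<sigma> c. strict_mono \<sigma> \<and> c > 0 \<and>
           (\<forall>F. finite F \<and> (\<forall>j\<in>F. card F \<le> j) \<longrightarrow>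
              norm (\<Sum>j\<in>F. x (\<sigma> j)) \<ge> c * real (card F) powr (1/p))))"

text \<open>X contains (an isomorphic copy of) \<ell>_1: some sequence is equivalent to the unit
  vector basis of \<ell>_1.\<close>
definition contains_l1 :: "'a::real_normed_vector itself \<Rightarrow> bool" where
  "contains_l1 _ \<longleftrightarrow>
     (\<exists>(x::nat \<Rightarrow> 'a) a b. 0 < a \<and>
        (\<forall>n c. a * (\<Sum>i<n. \<bar>c i\<bar>) \<le> norm (\<Sum>i<n. c i *\<^sub>R x i) \<and>
               norm (\<Sum>i<n. c i *\<^sub>R x i) \<le> b * (\<Sum>i<n. \<bar>c i\<bar>)))"

definition schauder_basis :: "(nat \<Rightarrow> 'a::real_normed_vector) \<Rightarrow> bool" where
  "schauder_basis e \<longleftrightarrow>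
     (\<forall>y. \<exists>!a::nat \<Rightarrow> real. (\<lambda>n. \<Sum>i<n. a i *\<^sub>R e i) \<longlonglongrightarrow> y)"

definition basis_coeffs :: "(nat \<Rightarrow> 'a::real_normed_vector) \<Rightarrow> 'a \<Rightarrow> nat \<Rightarrow> real" where
  "basis_coeffs e y = (THE a. (\<lambda>n. \<Sum>i<n. a i *\<^sub>R e i) \<longlonglongrightarrow> y)"

definition basis_support :: "(nat \<Rightarrow> 'a::real_normed_vector) \<Rightarrow> 'a \<Rightarrow> nat set" where
  "basis_support e y = {n. basis_coeffs e y n \<noteq> 0}"

definition one_unconditional_basis :: "(nat \<Rightarrow> 'a::real_normed_vector) \<Rightarrow> bool" where
  "one_unconditional_basis e \<longleftrightarrow> schauder_basis e \<and>
     (\<forall>n (a::nat \<Rightarrow> real) (\<epsilon>::nat \<Rightarrow> real). (\<forall>i. \<bar>\<epsilon> i\<bar> = 1) \<longrightarrow>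
        norm (\<Sum>i<n. (\<epsilon> i * a i) *\<^sub>R e i) \<le> norm (\<Sum>i<n. a i *\<^sub>R e i))"

definition lower_estimate_const1 :: "(nat \<Rightarrow> 'a::real_normed_vector) \<Rightarrow> real \<Rightarrow> bool" where
  "lower_estimate_const1 e q \<longleftrightarrow>
     (\<forall>k (y::nat \<Rightarrow> 'a).
        (\<forall>i<k. \<forall>j<k. i \<noteq> j \<longrightarrow> basis_support e (y i) \<inter> basis_support e (y j) = {}) \<longrightarrow>
        norm (\<Sum>i<k. y i) powr q \<ge> (\<Sum>i<k. norm (y i) powr q))"

definition reflexive :: "'a::real_normed_vector itself \<Rightarrow> bool" where
  "reflexive _ \<longleftrightarrow>
     (\<forall>\<phi>::('a \<Rightarrow>\<^sub>L real) \<Rightarrow>\<^sub>L real. \<exists>x::'a. \<forall>f. blinfun_apply \<phi> f = blinfun_apply f x)"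

definition omega_f :: "('a::real_normed_vector \<Rightarrow> 'b::real_normed_vector) \<Rightarrow> real \<Rightarrow> ereal" where
  "omega_f f t = (SUP xy\<in>{(x,y). norm (x - y) \<le> t}. ereal (norm (f (fst xy) - f (snd xy))))"

definition rho_f :: "('a::real_normed_vector \<Rightarrow> 'b::real_normed_vector) \<Rightarrow> real \<Rightarrow> ereal" where
  "rho_f f t = (INF xy\<in>{(x,y). norm (x - y) \<ge> t}. ereal (norm (f (fst xy) - f (snd xy))))"

definition coarse_lipschitz_embedding :: "('a::real_normed_vector \<Rightarrow> 'b::real_normed_vector) \<Rightarrow> bool" where
  "coarse_lipschitz_embedding f \<longleftrightarrow>
     (\<exists>L>0. \<forall>t\<ge>0. omega_f f t \<le> ereal (L * t + L) \<and> rho_f f t \<ge> ereal (t / L - L))"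

end

theory Submission
  imports Defs
begin

text \<open>
  Let \<open>f = (f\<^sub>1, f\<^sub>2)\<close> be a coarse Lipschitz embedding.  Pairs of far-apart points that nearly attain the
  Lipschitz constant of \<open>f\<^sub>1\<close> at infinity have their approximate midpoints mapped to approximate
  midpoints.  In \<open>X\<close> the approximate midpoints contain a ball of a finite-codimensional subspace \<open>E\<close>
  of radius of order \<open>\<delta>\<^bsup>1/p\<^esup>\<close>, while in \<open>Y\<^sub>1\<close> they lie within order \<open>\<delta>\<^bsup>1/q\<^sub>1\<^esup>\<close> of a finite set;
  since \<open>q\<^sub>1 < p\<close>, \<open>f\<^sub>1\<close> is almost finite-valued on some large ball \<open>u + \<tau> B\<^sub>E\<close>.

  In that ball one considers \<open>\<psi>(n\<^sub>1,\<dots>,n\<^sub>k) = u + r (y\<^bsub>n\<^sub>1\<^esub> + \<dots> + y\<^bsub>n\<^sub>k\<^esub>)\<close> with \<open>(y\<^sub>n)\<close> weakly null in \<open>E\<close>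
  and \<open>r\<close> of order \<open>\<tau> k\<^bsup>-1/p\<^esup>\<close>.  Asymptotic smoothness keeps the values in the ball, and \<open>f\<^sub>2 \<circ> \<psi>\<close>
  concentrates to within order \<open>r k\<^bsup>1/q\<^sub>2\<^esup> \<ll> \<tau>\<close> of a point, by a Kalton--Randrianarivony argument.
  Thus \<open>f \<circ> \<psi>\<close> is generically almost constant on the scale \<open>\<tau>\<close>, although the co-Banach--Saks
  property spreads the values of \<open>\<psi>\<close> by a fixed multiple of \<open>\<tau>\<close>.

  ``Generically'' refers throughout to iterates of a free ultrafilter, which replaces Ramsey's theorem
  and the passage to subsequences.  The weakly null sequence in \<open>X\<close> comes from asymptotic smoothness: unit
  vectors chosen successively in suitable finite-codimensional subspaces satisfy an upper \<open>p\<close>-estimate,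
  which forces them to be weakly null because \<open>p > 1\<close>.
\<close>

subsection \<open>The Hahn--Banach theorem\<close>

lemma minimal_element_exists:
  fixes A :: "'a::order set"
  assumes "a \<in> A"
    and lower: "\<And>C. C \<subseteq> A \<Longrightarrow> C \<noteq> {} \<Longrightarrow> (\<And>x y. x \<in> C \<Longrightarrow> y \<in> C \<Longrightarrow> x \<le> y \<or> y \<le> x)
      \<Longrightarrow> \<exists>u\<in>A. \<forall>x\<in>C. u \<le> x"
  obtains m where "m \<in> A" "\<And>x. x \<in> A \<Longrightarrow> x \<le> m \<Longrightarrow> x = m"
proof -
  have "\<exists>m\<in>A. \<forall>x\<in>A. x \<le> m \<longrightarrow> x = m"
  proof (rule predicate_Zorn)
    show "partial_order_on A (relation_of (\<lambda>x y. y \<le> x) A)"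
      by (rule partial_order_on_relation_ofI) auto
  next
    fix C assume C: "C \<in> Chains (relation_of (\<lambda>x y. y \<le> x) A)"
    have "C \<subseteq> A" using C by (rule Chains_relation_of)
    moreover have "x \<le> y \<or> y \<le> x" if "x \<in> C" "y \<in> C" for x y
      using C that unfolding Chains_def relation_of_def by blast
    ultimately show "\<exists>u\<in>A. \<forall>x\<in>C. u \<le> x"
      using lower[of C] \<open>a \<in> A\<close> by (cases "C = {}") auto
  qed
  thus ?thesis using that by blast
qed

definition sublinear :: "('a::real_vector \<Rightarrow> real) \<Rightarrow> bool" where
  "sublinear p \<longleftrightarrow> (\<forall>x y. p (x + y) \<le> p x + p y) \<and> (\<forall>c x. 0 \<le> c \<longrightarrow> p (c *\<^sub>R x) = c * p x)"

lemma sublinear_add: "sublinear p \<Longrightarrow> p (x + y) \<le> p x + p y"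
  by (simp add: sublinear_def)

lemma sublinear_scale: "sublinear p \<Longrightarrow> 0 \<le> c \<Longrightarrow> p (c *\<^sub>R x) = c * p x"
  by (simp add: sublinear_def)

lemma sublinear_zero: "sublinear p \<Longrightarrow> p 0 = 0"
  using sublinear_scale[of p 0 0] by simp

lemma sublinear_ge_minus: "sublinear p \<Longrightarrow> - p (- x) \<le> p x"
  using sublinear_add[of p x "- x"] sublinear_zero[of p] by simp

lemma sublinearI:
  assumes add: "\<And>x y. p (x + y) \<le> p x + p y"
    and scale: "\<And>c x. 0 < c \<Longrightarrow> p (c *\<^sub>R x) \<le> c * p x"
  shows "sublinear p"
  unfolding sublinear_def
proof (intro conjI allI impI)
  fix c :: real and x assume "0 \<le> c"
  show "p (c *\<^sub>R x) = c * p x"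
  proof (cases "c = 0")
    case True
    thus ?thesis using scale[of 2 0] scale[of "1 / 2" 0] by simp
  next
    case False
    hence "0 < c" using \<open>0 \<le> c\<close> by simp
    hence "p (inverse c *\<^sub>R (c *\<^sub>R x)) \<le> inverse c * p (c *\<^sub>R x)" by (intro scale) simp
    hence "c * p x \<le> p (c *\<^sub>R x)" using \<open>0 < c\<close> by (simp add: field_simps)
    with scale[OF \<open>0 < c\<close>, of x] show ?thesis by simp
  qed
qed (rule add)

lemma sublinear_INF:
  fixes h :: "'a::real_vector \<Rightarrow> 'b \<Rightarrow> real"
  assumes "K \<noteq> {}" and bdd: "\<And>x. bdd_below (h x ` K)"
    and add: "\<And>x y k l. k \<in> K \<Longrightarrow> l \<in> K \<Longrightarrow> \<exists>m\<in>K. h (x + y) m \<le> h x k + h y l"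
    and scale: "\<And>c x k. 0 < c \<Longrightarrow> k \<in> K \<Longrightarrow> \<exists>m\<in>K. h (c *\<^sub>R x) m \<le> c * h x k"
  shows "sublinear (\<lambda>x. INF k\<in>K. h x k)"
proof (rule sublinearI)
  let ?p = "\<lambda>x. INF k\<in>K. h x k"
  have lower: "?p x \<le> h x k" if "k \<in> K" for x k using that by (intro cINF_lower bdd)
  have greatest: "b \<le> ?p x" if "\<And>k. k \<in> K \<Longrightarrow> b \<le> h x k" for b x
    using that \<open>K \<noteq> {}\<close> by (intro cINF_greatest)
  show "?p (x + y) \<le> ?p x + ?p y" for x y
  proof -
    have "?p (x + y) \<le> h x k + h y l" if "k \<in> K" "l \<in> K" for k l
      using add[OF that, of x y] lower order_trans by blast
    hence "?p (x + y) - h x k \<le> ?p y" if "k \<in> K" for k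
      using that by (intro greatest) (simp add: diff_le_eq add.commute)
    hence "?p (x + y) - ?p y \<le> ?p x" by (intro greatest) (simp add: diff_le_eq add.commute)
    thus ?thesis by simp
  qed
  show "?p (c *\<^sub>R x) \<le> c * ?p x" if "0 < c" for c x
  proof -
    have "?p (c *\<^sub>R x) / c \<le> h x k" if "k \<in> K" for k
    proof -
      have "?p (c *\<^sub>R x) \<le> c * h x k" using scale[OF \<open>0 < c\<close> that] lower order_trans by blast
      thus ?thesis using \<open>0 < c\<close> by (simp add: field_simps)
    qed
    hence "?p (c *\<^sub>R x) / c \<le> ?p x" by (rule greatest)
    thus ?thesis using \<open>0 < c\<close> by (simp add: field_simps)
  qed
qed

lemma sublinear_below_increment:
  fixes p :: "'a::real_vector \<Rightarrow> real"
  assumes p: "sublinear p"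
  obtains p' where "sublinear p'" "\<And>z. p' z \<le> p z" "\<And>z. p' z \<le> p (z + y) - p y"
proof
  define h where "h z t = p (z + t *\<^sub>R y) - t * p y" for z t
  let ?p' = "\<lambda>z. INF t\<in>{0..}. h z t"
  have "- p (- z) \<le> h z t" if "t \<ge> 0" for z t
  proof -
    have "p (t *\<^sub>R y) \<le> p (z + t *\<^sub>R y) + p (- z)"
      using sublinear_add[OF p, of "z + t *\<^sub>R y" "- z"] by simp
    thus ?thesis using sublinear_scale[OF p that, of y] by (simp add: h_def)
  qed
  hence bdd: "bdd_below (h z ` {0..})" for z by (intro bdd_belowI[of _ "- p (- z)"]) auto
  show "sublinear ?p'"
  proof (rule sublinear_INF)
    fix x z :: 'a and s t :: real assume "s \<in> {0..}" "t \<in> {0..}"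
    moreover have "h (x + z) (s + t) \<le> h x s + h z t"
      using sublinear_add[OF p, of "x + s *\<^sub>R y" "z + t *\<^sub>R y"] by (simp add: h_def algebra_simps)
    ultimately show "\<exists>m\<in>{0..}. h (x + z) m \<le> h x s + h z t"
      by (intro bexI[of _ "s + t"]) auto
  next
    fix c t :: real and x :: 'a assume "0 < c" "t \<in> {0..}"
    moreover have "h (c *\<^sub>R x) (c * t) = c * h x t"
      using sublinear_scale[OF p, of c "x + t *\<^sub>R y"] \<open>0 < c\<close> by (simp add: h_def algebra_simps)
    ultimately show "\<exists>m\<in>{0..}. h (c *\<^sub>R x) m \<le> c * h x t"
      by (intro bexI[of _ "c * t"]) auto
  qed (auto intro: bdd)
  show "?p' z \<le> p z" for z using cINF_lower[OF bdd, of 0 z] by (simp add: h_def)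
  show "?p' z \<le> p (z + y) - p y" for z using cINF_lower[OF bdd, of 1 z] by (simp add: h_def)
qed

lemma minimal_sublinear_exists:
  fixes p :: "'a::real_vector \<Rightarrow> real"
  assumes p: "sublinear p"
  obtains m where "sublinear m" "m \<le> p" "\<And>q. sublinear q \<Longrightarrow> q \<le> m \<Longrightarrow> q = m"
proof -
  let ?A = "{q. sublinear q \<and> q \<le> p}"
  have lower_bound: "- p (- x) \<le> q x" if "q \<in> ?A" for q x
    using sublinear_ge_minus[of q x] that by (auto simp: le_fun_def intro: order_trans[rotated])
  have "\<exists>u\<in>?A. \<forall>q\<in>C. u \<le> q"
    if C: "C \<subseteq> ?A" "C \<noteq> {}" and chain: "\<And>q r. q \<in> C \<Longrightarrow> r \<in> C \<Longrightarrow> q \<le> r \<or> r \<le> q" for C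
  proof -
    let ?u = "\<lambda>x. INF q\<in>C. q x"
    have bdd: "bdd_below ((\<lambda>q. q x) ` C)" for x
      using C(1) lower_bound by (intro bdd_belowI[of _ "- p (- x)"]) auto
    have below: "?u \<le> q" if "q \<in> C" for q
      unfolding le_fun_def using that by (intro allI cINF_lower bdd)
    have "sublinear ?u"
    proof (rule sublinear_INF[OF C(2) bdd])
      fix x y q r assume qr: "q \<in> C" "r \<in> C"
      then obtain m where "m \<in> C" "m \<le> q" "m \<le> r" using chain[OF qr] by blast
      moreover have "m (x + y) \<le> m x + m y" using \<open>m \<in> C\<close> C(1) by (intro sublinear_add) auto
      ultimately show "\<exists>m\<in>C. m (x + y) \<le> q x + r y"
        by (meson add_mono le_funD order_trans)
    next
      fix c x q assume "0 < (c::real)" "q \<in> C"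
      thus "\<exists>m\<in>C. m (c *\<^sub>R x) \<le> c * q x"
        using C(1) by (intro bexI[of _ q]) (auto simp: sublinear_scale)
    qed
    moreover have "?u \<le> p" using C below order_trans by blast
    ultimately show ?thesis using below by blast
  qed
  then obtain m where "m \<in> ?A" "\<And>q. q \<in> ?A \<Longrightarrow> q \<le> m \<Longrightarrow> q = m"
    using minimal_element_exists[of p ?A] p by auto
  thus ?thesis using that[of m] order_trans by blast
qed

lemma minimal_sublinear_linear:
  fixes m :: "'a::real_vector \<Rightarrow> real"
  assumes m: "sublinear m" and minimal: "\<And>q. sublinear q \<Longrightarrow> q \<le> m \<Longrightarrow> q = m"
  shows "linear m"
proof (rule linearI)
  show add: "m (x + y) = m x + m y" for x y
  proof -
    obtain q where q: "sublinear q" "\<And>z. q z \<le> m z" "\<And>z. q z \<le> m (z + y) - m y"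
      using sublinear_below_increment[OF m] by metis
    have "q = m" using minimal q by (simp add: le_fun_def)
    thus ?thesis using q(3)[of x] sublinear_add[OF m, of x y] by simp
  qed
  have minus: "m (- x) = - m x" for x
    using add[of x "- x"] sublinear_zero[OF m] by simp
  show "m (c *\<^sub>R x) = c *\<^sub>R m x" for c x
    using sublinear_scale[OF m, of c x] sublinear_scale[OF m, of "- c" x] minus[of "c *\<^sub>R x"]
    by (cases "c \<ge> 0") auto
qed

lemma sublinear_supporting_linear:
  fixes p :: "'a::real_vector \<Rightarrow> real"
  assumes p: "sublinear p"
  obtains g where "linear g" "\<And>z. g z \<le> p z" "g y = p y"
proof -
  obtain q where q: "sublinear q" "\<And>z. q z \<le> p z" "\<And>z. q z \<le> p (z + y) - p y"
    using sublinear_below_increment[OF p] by metis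
  obtain g where g: "sublinear g" "g \<le> q" "\<And>r. sublinear r \<Longrightarrow> r \<le> g \<Longrightarrow> r = g"
    using minimal_sublinear_exists[OF q(1)] by metis
  have lin: "linear g" using g(1,3) by (rule minimal_sublinear_linear)
  have le: "g z \<le> q z" for z using g(2) by (simp add: le_fun_def)
  have "g (- y) \<le> - p y" using le[of "- y"] q(3)[of "- y"] sublinear_zero[OF p] by simp
  hence "p y \<le> g y" using linear_neg[OF lin, of y] by simp
  thus ?thesis using that[OF lin] le q(2) order_trans antisym by metis
qed

lemma sublinear_infdist:
  fixes E :: "'a::real_normed_vector set"
  assumes E: "subspace E"
  shows "sublinear (\<lambda>x. infdist x E)"
proof -
  have "E \<noteq> {}" using subspace_0[OF E] by blast
  moreover have "sublinear (\<lambda>x. INF a\<in>E. dist x a)"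
  proof (rule sublinear_INF)
    show "\<exists>m\<in>E. dist (x + y) m \<le> dist x a + dist y b" if "a \<in> E" "b \<in> E" for x y a b
      using that subspace_add[OF E] dist_triangle_add by blast
    show "\<exists>m\<in>E. dist (c *\<^sub>R x) m \<le> c * dist x a" if "0 < c" "a \<in> E" for c x a
      using that subspace_scale[OF E, of a c]
      by (intro bexI[of _ "c *\<^sub>R a"]) (auto simp: dist_norm simp flip: scaleR_right_diff_distrib)
  qed (use \<open>E \<noteq> {}\<close> in auto)
  ultimately show ?thesis by (simp add: infdist_def)
qed

lemma infdist_minus:
  fixes E :: "'a::real_normed_vector set"
  assumes "subspace E"
  shows "infdist (- x) E = infdist x E"
proof -
  have "E = uminus ` E" using subspace_neg[OF assms] by (force simp: image_iff)
  hence "dist (- x) ` E = (\<lambda>a. dist (- x) (- a)) ` E" by (metis image_image)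
  thus ?thesis by (simp add: infdist_def dist_norm norm_minus_commute)
qed

lemma functional_attaining_infdist:
  fixes E :: "'a::real_normed_vector set"
  assumes E: "subspace E"
  obtains g :: "'a \<Rightarrow>\<^sub>L real" where "\<And>z. \<bar>g z\<bar> \<le> infdist z E" "g x = infdist x E"
proof -
  obtain g where g: "linear g" "\<And>z. g z \<le> infdist z E" "g x = infdist x E"
    using sublinear_supporting_linear[OF sublinear_infdist[OF E]] by metis
  have "- g z \<le> infdist z E" for z
    using g(2)[of "- z"] linear_neg[OF g(1)] infdist_minus[OF E, of z] by simp
  hence bound: "\<bar>g z\<bar> \<le> infdist z E" for z using g(2)[of z] by (simp add: abs_le_iff)
  have "\<bar>g z\<bar> \<le> norm z" for z
    using bound[of z] infdist_le[OF subspace_0[OF E], of z] by simp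
  hence "bounded_linear g"
    using g(1) by (intro bounded_linear_intro[of g 1]) (simp_all add: linear_add linear_scale)
  thus ?thesis
    using bound g(3) by (intro that[of "Blinfun g"]) (simp_all add: bounded_linear_Blinfun_apply)
qed

lemma norming_functional:
  fixes x :: "'a::real_normed_vector"
  obtains g :: "'a \<Rightarrow>\<^sub>L real" where "\<And>z. \<bar>g z\<bar> \<le> norm z" "g x = norm x"
  using functional_attaining_infdist[of "{0::'a}" x] that by (auto simp: infdist_def)

lemma functional_separating_closed_subspace:
  fixes E :: "'a::real_normed_vector set"
  assumes E: "subspace E" "closed E" and x: "x \<notin> E"
  obtains g :: "'a \<Rightarrow>\<^sub>L real" where "\<And>z. z \<in> E \<Longrightarrow> g z = 0" "g x = 1"
proof -
  obtain g :: "'a \<Rightarrow>\<^sub>L real" where g: "\<And>z. \<bar>g z\<bar> \<le> infdist z E" "g x = infdist x E"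
    using functional_attaining_infdist[OF E(1)] by blast
  have "E \<noteq> {}" using subspace_0[OF E(1)] by blast
  hence "infdist x E \<noteq> 0" using in_closed_iff_infdist_zero[OF E(2)] x by blast
  moreover have "g z = 0" if "z \<in> E" for z using g(1)[of z] that by simp
  ultimately show ?thesis
    using g(2) by (intro that[of "g /\<^sub>R infdist x E"]) (simp_all add: blinfun.scaleR_left)
qed

subsection \<open>Ultrafilters and iterated filters\<close>

definition ultrafilter :: "'a filter \<Rightarrow> bool" where
  "ultrafilter F \<longleftrightarrow> F \<noteq> bot \<and> (\<forall>P. eventually P F \<or> (\<forall>\<^sub>F x in F. \<not> P x))"

lemma ultrafilter_below_exists:
  fixes F :: "'a filter"
  assumes "F \<noteq> bot"
  obtains U where "ultrafilter U" "U \<le> F"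
proof -
  let ?A = "{U. U \<noteq> bot \<and> U \<le> F}"
  have "\<exists>u\<in>?A. \<forall>G\<in>C. u \<le> G"
    if C: "C \<subseteq> ?A" "C \<noteq> {}" and chain: "\<And>G H. G \<in> C \<Longrightarrow> H \<in> C \<Longrightarrow> G \<le> H \<or> H \<le> G" for C
  proof -
    have "eventually P (Inf C) \<longleftrightarrow> (\<exists>G\<in>C. eventually P G)" for P
      using chain
      by (intro eventually_Inf_base C(2)) (metis inf.absorb_iff1 inf.absorb_iff2 order_refl)
    hence "Inf C \<noteq> bot" using C(1) by (auto simp: trivial_limit_def)
    moreover have "Inf C \<le> F" using C by (auto intro: Inf_lower2)
    ultimately show ?thesis by (intro bexI[of _ "Inf C"]) (auto intro: Inf_lower)
  qed
  then obtain U where U: "U \<in> ?A" "\<And>G. G \<in> ?A \<Longrightarrow> G \<le> U \<Longrightarrow> G = U"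
    using minimal_element_exists[of F ?A] assms by auto
  have "eventually P U \<or> (\<forall>\<^sub>F x in U. \<not> P x)" for P
  proof (cases "inf U (principal {x. P x}) = bot")
    case True
    thus ?thesis by (simp add: trivial_limit_def eventually_inf_principal)
  next
    case False
    hence "inf U (principal {x. P x}) = U" using U(1) by (intro U(2)) (auto intro: le_infI1)
    moreover have "eventually P (inf U (principal {x. P x}))"
      by (simp add: eventually_inf_principal)
    ultimately show ?thesis by simp
  qed
  thus ?thesis using U(1) that by (auto simp: ultrafilter_def)
qed

lemma ultrafilter_finite_Bex:
  assumes U: "ultrafilter U" and "finite A" "\<forall>\<^sub>F x in U. \<exists>a\<in>A. P a x"
  obtains a where "a \<in> A" "\<forall>\<^sub>F x in U. P a x"
proof -
  have "\<exists>a\<in>A. \<forall>\<^sub>F x in U. P a x"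
  proof (rule ccontr)
    assume "\<not> ?thesis"
    hence "\<forall>a\<in>A. \<forall>\<^sub>F x in U. \<not> P a x" using U by (auto simp: ultrafilter_def)
    hence "\<forall>\<^sub>F x in U. \<forall>a\<in>A. \<not> P a x" using \<open>finite A\<close> by (simp add: eventually_ball_finite)
    hence "\<forall>\<^sub>F x in U. False" using assms(3) by eventually_elim blast
    thus False using U by (simp add: ultrafilter_def trivial_limit_def)
  qed
  thus ?thesis using that by blast
qed

lemma ultrafilter_limit_in_compact:
  assumes U: "ultrafilter U" and "compact K" "\<forall>\<^sub>F x in U. f x \<in> K"
  obtains l where "l \<in> K" "(f \<longlongrightarrow> l) U"
proof -
  have "filtermap f U \<noteq> bot" using U by (simp add: ultrafilter_def filtermap_bot_iff)
  moreover have "\<forall>\<^sub>F y in filtermap f U. y \<in> K" using assms(3) by (simp add: eventually_filtermap)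
  ultimately obtain l where l: "l \<in> K" "inf (nhds l) (filtermap f U) \<noteq> bot"
    using \<open>compact K\<close> unfolding compact_filter by blast
  have "(f \<longlongrightarrow> l) U"
  proof (rule topological_tendstoI, rule ccontr)
    fix S assume S: "open S" "l \<in> S" "\<not> (\<forall>\<^sub>F x in U. f x \<in> S)"
    hence "\<forall>\<^sub>F y in filtermap f U. y \<notin> S"
      using U by (auto simp: ultrafilter_def eventually_filtermap)
    moreover have "\<forall>\<^sub>F y in nhds l. y \<in> S" using S by (intro eventually_nhds_in_open)
    ultimately have "\<forall>\<^sub>F y in inf (nhds l) (filtermap f U). False"
      by (auto simp: eventually_inf)
    thus False using l(2) by (simp add: trivial_limit_def)
  qed
  thus ?thesis using l(1) that by blast
qed

definition filter_bind :: "'a filter \<Rightarrow> ('a \<Rightarrow> 'b filter) \<Rightarrow> 'b filter" where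
  "filter_bind F G = Abs_filter (\<lambda>P. \<forall>\<^sub>F x in F. eventually P (G x))"

lemma eventually_filter_bind:
  fixes G :: "'a \<Rightarrow> 'b filter"
  shows "eventually P (filter_bind F G) \<longleftrightarrow> (\<forall>\<^sub>F x in F. eventually P (G x))"
  unfolding filter_bind_def
proof (rule eventually_Abs_filter, rule is_filter.intro)
  fix P Q :: "'b \<Rightarrow> bool"
  assume "\<forall>\<^sub>F x in F. eventually P (G x)" "\<forall>\<^sub>F x in F. eventually Q (G x)"
  thus "\<forall>\<^sub>F x in F. \<forall>\<^sub>F y in G x. P y \<and> Q y" by eventually_elim (rule eventually_conj)
next
  fix P Q :: "'b \<Rightarrow> bool"
  assume "\<forall>y. P y \<longrightarrow> Q y" "\<forall>\<^sub>F x in F. eventually P (G x)"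
  thus "\<forall>\<^sub>F x in F. eventually Q (G x)" by (auto elim!: eventually_mono)
qed simp

text \<open>A property holds eventually along \<open>iter_filter F k\<close> iff it holds for all
  \<open>[n\<^sub>1, \<dots>, n\<^sub>k]\<close> with \<open>n\<^sub>1\<close> far out in \<open>F\<close>, \<open>n\<^sub>2\<close> far out depending on \<open>n\<^sub>1\<close>, and so on.\<close>

primrec iter_filter :: "'a filter \<Rightarrow> nat \<Rightarrow> 'a list filter" where
  "iter_filter F 0 = principal {[]}"
| "iter_filter F (Suc k) = filter_bind F (\<lambda>n. filtermap (Cons n) (iter_filter F k))"

lemma eventually_iter_filter_0: "eventually P (iter_filter F 0) \<longleftrightarrow> P []"
  by (simp add: eventually_principal)

lemma eventually_iter_filter_Suc:
  "eventually P (iter_filter F (Suc k)) \<longleftrightarrow> (\<forall>\<^sub>F n in F. \<forall>\<^sub>F l in iter_filter F k. P (n # l))"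
  by (simp add: eventually_filter_bind eventually_filtermap)

declare iter_filter.simps [simp del]

lemmas eventually_iter_filter [simp] = eventually_iter_filter_0 eventually_iter_filter_Suc

lemma iter_filter_neq_bot:
  assumes "F \<noteq> bot"
  shows "iter_filter F k \<noteq> bot"
  using assms by (induction k) (auto simp: trivial_limit_def)

lemma ultrafilter_iter_filter:
  assumes "ultrafilter U"
  shows "ultrafilter (iter_filter U k)"
proof -
  have "eventually P (iter_filter U k) \<or> (\<forall>\<^sub>F l in iter_filter U k. \<not> P l)" for P
  proof (induction k arbitrary: P)
    case (Suc k)
    consider "\<forall>\<^sub>F n in U. \<forall>\<^sub>F l in iter_filter U k. P (n # l)"
      | "\<forall>\<^sub>F n in U. \<not> (\<forall>\<^sub>F l in iter_filter U k. P (n # l))"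
      using assms by (auto simp: ultrafilter_def)
    thus ?case
    proof cases
      case 2
      hence "\<forall>\<^sub>F n in U. \<forall>\<^sub>F l in iter_filter U k. \<not> P (n # l)"
        by (rule eventually_mono) (use Suc.IH in blast)
      thus ?thesis by simp
    qed simp
  qed simp
  thus ?thesis using assms iter_filter_neq_bot[of U k] by (simp add: ultrafilter_def)
qed

lemma eventually_iter_filter_length: "\<forall>\<^sub>F l in iter_filter F k. length l = k"
  by (induction k) auto

lemma eventually_iter_filter_set:
  assumes "eventually P F"
  shows "\<forall>\<^sub>F l in iter_filter F k. \<forall>n\<in>set l. P n"
proof (induction k)
  case (Suc k)
  thus ?case using assms by (auto elim!: eventually_mono)
qed simp

lemma eventually_iter_filter_distinct:
  assumes "F \<le> cofinite"
  shows "\<forall>\<^sub>F l in iter_filter F k. distinct l"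
proof (induction k)
  case (Suc k)
  have "\<forall>\<^sub>F l in iter_filter F k. distinct (n # l)" for n
  proof -
    have "\<forall>\<^sub>F m in F. m \<noteq> n" using assms by (rule filter_leD) (simp add: eventually_cofinite)
    hence "\<forall>\<^sub>F l in iter_filter F k. \<forall>m\<in>set l. m \<noteq> n" by (rule eventually_iter_filter_set)
    with Suc.IH show ?thesis by eventually_elim auto
  qed
  thus ?case by simp
qed simp

lemma tendsto_iter_filter_Suc:
  fixes f :: "'a list \<Rightarrow> 'b::metric_space"
  assumes f: "\<And>n. ((\<lambda>l. f (n # l)) \<longlongrightarrow> a n) (iter_filter F k)" and a: "(a \<longlongrightarrow> b) F"
  shows "(f \<longlongrightarrow> b) (iter_filter F (Suc k))"
proof (rule tendstoI)
  fix \<epsilon> :: real assume "\<epsilon> > 0"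
  hence "\<forall>\<^sub>F n in F. dist (a n) b < \<epsilon> / 2" using tendstoD[OF a, of "\<epsilon> / 2"] by simp
  hence "\<forall>\<^sub>F n in F. \<forall>\<^sub>F l in iter_filter F k. dist (f (n # l)) b < \<epsilon>"
  proof eventually_elim
    case (elim n)
    have "\<forall>\<^sub>F l in iter_filter F k. dist (f (n # l)) (a n) < \<epsilon> / 2"
      using tendstoD[OF f, of "\<epsilon> / 2"] \<open>\<epsilon> > 0\<close> by simp
    thus ?case by eventually_elim (rule dist_triangle_half_r, use elim in \<open>simp_all add: dist_commute\<close>)
  qed
  thus "\<forall>\<^sub>F l in iter_filter F (Suc k). dist (f l) b < \<epsilon>" by simp
qed

lemma tendsto_iter_filter_sum_list:
  fixes x :: "'a \<Rightarrow> 'b::real_normed_vector"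
  assumes "(x \<longlongrightarrow> 0) F"
  shows "((\<lambda>l. \<Sum>n\<leftarrow>l. x n) \<longlongrightarrow> 0) (iter_filter F k)"
proof (induction k)
  case 0
  show ?case by (simp add: tendsto_iff)
next
  case (Suc k)
  have "((\<lambda>l. \<Sum>m\<leftarrow>n # l. x m) \<longlongrightarrow> x n) (iter_filter F k)" for n
    using tendsto_add[OF tendsto_const Suc.IH, of "x n"] by simp
  thus ?case using assms by (rule tendsto_iter_filter_Suc)
qed

subsection \<open>Weak convergence along filters\<close>

definition tendsto_weakly :: "('b \<Rightarrow> 'a::real_normed_vector) \<Rightarrow> 'a \<Rightarrow> 'b filter \<Rightarrow> bool" where
  "tendsto_weakly f l F \<longleftrightarrow> (\<forall>g::'a \<Rightarrow>\<^sub>L real. ((\<lambda>x. g (f x)) \<longlongrightarrow> g l) F)"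

definition weakly_null_unit_seqs :: "nat filter \<Rightarrow> 'a::real_normed_vector set \<Rightarrow> (nat \<Rightarrow> 'a) set" where
  "weakly_null_unit_seqs F E = {x. tendsto_weakly x 0 F \<and> (\<forall>n. x n \<in> E \<and> norm (x n) \<le> 1)}"

lemma weakly_null_iff_tendsto_weakly: "weakly_null x \<longleftrightarrow> tendsto_weakly x 0 sequentially"
  by (simp add: weakly_null_def tendsto_weakly_def)

lemma tendsto_weaklyD:
  fixes g :: "'a::real_normed_vector \<Rightarrow>\<^sub>L real"
  shows "tendsto_weakly f l F \<Longrightarrow> ((\<lambda>x. g (f x)) \<longlongrightarrow> g l) F"
  by (simp add: tendsto_weakly_def)

lemma tendsto_imp_tendsto_weakly: "(f \<longlongrightarrow> l) F \<Longrightarrow> tendsto_weakly f l F"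
  by (simp add: tendsto_weakly_def blinfun.tendsto)

lemma tendsto_weakly_diff:
  "tendsto_weakly f a F \<Longrightarrow> tendsto_weakly h b F \<Longrightarrow> tendsto_weakly (\<lambda>x. f x - h x) (a - b) F"
  by (simp add: tendsto_weakly_def blinfun.diff_right tendsto_diff)

lemma tendsto_weakly_scaleR:
  "tendsto_weakly f a F \<Longrightarrow> tendsto_weakly (\<lambda>x. c *\<^sub>R f x) (c *\<^sub>R a) F"
  by (simp add: tendsto_weakly_def blinfun.scaleR_right tendsto_mult_left)

lemma tendsto_weakly_mono: "tendsto_weakly f a F \<Longrightarrow> G \<le> F \<Longrightarrow> tendsto_weakly f a G"
  unfolding tendsto_weakly_def using tendsto_mono by blast

lemma tendsto_weakly_compose:
  "tendsto_weakly f a F \<Longrightarrow> filterlim h F G \<Longrightarrow> tendsto_weakly (\<lambda>x. f (h x)) a G"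
  unfolding tendsto_weakly_def
  using filterlim_compose[where g = "\<lambda>x. blinfun_apply k (f x)" and f = h for k] by fast

lemma norm_tendsto_weakly_le:
  fixes f :: "'b \<Rightarrow> 'a::real_normed_vector"
  assumes f: "tendsto_weakly f l F" and "F \<noteq> bot" and bound: "\<forall>\<^sub>F x in F. norm (f x) \<le> B"
  shows "norm l \<le> B"
proof -
  obtain g :: "'a \<Rightarrow>\<^sub>L real" where g: "\<And>z. \<bar>g z\<bar> \<le> norm z" "g l = norm l"
    using norming_functional by blast
  have "\<forall>\<^sub>F x in F. g (f x) \<le> B" using bound by eventually_elim (meson abs_le_D1 g(1) order_trans)
  thus ?thesis using tendsto_upperbound[OF tendsto_weaklyD[OF f, of g] _ \<open>F \<noteq> bot\<close>] g(2) by simp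
qed

lemma tendsto_weakly_iter_filter_Suc:
  fixes f :: "'b list \<Rightarrow> 'a::real_normed_vector"
  assumes "\<And>n. tendsto_weakly (\<lambda>l. f (n # l)) (a n) (iter_filter F k)" and "tendsto_weakly a b F"
  shows "tendsto_weakly f b (iter_filter F (Suc k))"
  unfolding tendsto_weakly_def
proof
  fix g :: "'a \<Rightarrow>\<^sub>L real"
  show "((\<lambda>l. g (f l)) \<longlongrightarrow> g b) (iter_filter F (Suc k))"
    using assms by (intro tendsto_iter_filter_Suc[where a = "\<lambda>n. g (a n)"] tendsto_weaklyD)
qed

lemma tendsto_weakly_iter_filter_sum_list:
  fixes x :: "'b \<Rightarrow> 'a::real_normed_vector"
  assumes x: "tendsto_weakly x 0 F"
  shows "tendsto_weakly (\<lambda>l. \<Sum>n\<leftarrow>l. x n) 0 (iter_filter F k)"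
  unfolding tendsto_weakly_def
proof
  fix g :: "'a \<Rightarrow>\<^sub>L real"
  have "((\<lambda>n. g (x n)) \<longlongrightarrow> 0) F" using tendsto_weaklyD[OF x, of g] by simp
  hence "((\<lambda>l. \<Sum>n\<leftarrow>l. g (x n)) \<longlongrightarrow> 0) (iter_filter F k)" by (rule tendsto_iter_filter_sum_list)
  moreover have "g (\<Sum>n\<leftarrow>l. x n) = (\<Sum>n\<leftarrow>l. g (x n))" for l
    by (induction l) (simp_all add: blinfun.add_right)
  ultimately show "((\<lambda>l. g (\<Sum>n\<leftarrow>l. x n)) \<longlongrightarrow> g 0) (iter_filter F k)" by simp
qed

lemma weakly_null_separated_pair:
  fixes x :: "'b \<Rightarrow> 'a::real_normed_vector"
  assumes x: "tendsto_weakly x 0 F" and "F \<noteq> bot" and "b > 0"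
    and large: "\<forall>\<^sub>F i in F. b \<le> norm (x i)" and P: "eventually P F"
  obtains i j where "P i" "P j" "b / 2 \<le> norm (x i - x j)"
proof -
  obtain i where i: "P i" "b \<le> norm (x i)"
    using eventually_happens'[OF \<open>F \<noteq> bot\<close> eventually_conj[OF P large]] by blast
  have "\<not> (\<forall>\<^sub>F j in F. norm (x i - x j) \<le> b / 2)"
  proof
    assume "\<forall>\<^sub>F j in F. norm (x i - x j) \<le> b / 2"
    moreover have "tendsto_weakly (\<lambda>j. x i - x j) (x i - 0) F"
      by (rule tendsto_weakly_diff[OF tendsto_imp_tendsto_weakly[OF tendsto_const] x])
    ultimately have "norm (x i) \<le> b / 2" using norm_tendsto_weakly_le[OF _ \<open>F \<noteq> bot\<close>] by fastforce
    thus False using i(2) \<open>b > 0\<close> by simp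
  qed
  hence "\<exists>\<^sub>F j in F. \<not> norm (x i - x j) \<le> b / 2" by (simp add: frequently_def)
  then obtain j where "\<not> norm (x i - x j) \<le> b / 2" "P j"
    using frequently_ex[OF frequently_eventually_frequently[OF _ P]] by blast
  thus ?thesis using i(1) by (intro that[of i j]) auto
qed

lemma reflexive_bounded_weak_limit:
  fixes y :: "'b \<Rightarrow> 'a::real_normed_vector"
  assumes refl: "reflexive TYPE('a)" and U: "ultrafilter U" and bound: "\<And>n. norm (y n) \<le> B"
  obtains l where "tendsto_weakly y l U"
proof -
  have "U \<noteq> bot" using U by (simp add: ultrafilter_def)
  note unique = tendsto_unique[OF this]
  have bound': "norm (g (y n)) \<le> norm g * B" for g :: "'a \<Rightarrow>\<^sub>L real" and n
    using norm_blinfun[of g "y n"] mult_left_mono[OF bound[of n] norm_ge_zero[of g]] by linarith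
  have "\<exists>l. norm l \<le> norm g * B \<and> ((\<lambda>n. g (y n)) \<longlongrightarrow> l) U" for g :: "'a \<Rightarrow>\<^sub>L real"
  proof -
    have "\<forall>\<^sub>F n in U. g (y n) \<in> cball 0 (norm g * B)" using bound'[of g] by simp
    then obtain l where "l \<in> cball 0 (norm g * B)" "((\<lambda>n. g (y n)) \<longlongrightarrow> l) U"
      by (rule ultrafilter_limit_in_compact[OF U compact_cball])
    thus ?thesis by auto
  qed
  then obtain \<phi> :: "('a \<Rightarrow>\<^sub>L real) \<Rightarrow> real"
    where \<phi>: "\<And>g. norm (\<phi> g) \<le> norm g * B" "\<And>g. ((\<lambda>n. blinfun_apply g (y n)) \<longlongrightarrow> \<phi> g) U"
    by metis
  have "bounded_linear \<phi>"
  proof (rule bounded_linear_intro[OF _ _ \<phi>(1)])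
    fix g h :: "'a \<Rightarrow>\<^sub>L real" and c :: real
    have "((\<lambda>n. (g + h) (y n)) \<longlongrightarrow> \<phi> g + \<phi> h) U"
      using tendsto_add[OF \<phi>(2)[of g] \<phi>(2)[of h]] by (simp add: blinfun.add_left)
    thus "\<phi> (g + h) = \<phi> g + \<phi> h" by (rule unique[OF \<phi>(2)])
    have "((\<lambda>n. (c *\<^sub>R g) (y n)) \<longlongrightarrow> c *\<^sub>R \<phi> g) U"
      using tendsto_scaleR[OF tendsto_const \<phi>(2)[of g], of c] by (simp add: blinfun.scaleR_left)
    thus "\<phi> (c *\<^sub>R g) = c *\<^sub>R \<phi> g" by (rule unique[OF \<phi>(2)])
  qed
  then obtain l where "\<And>g. \<phi> g = blinfun_apply g l"
    using refl unfolding reflexive_def by (metis bounded_linear_Blinfun_apply)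
  thus ?thesis using \<phi>(2) by (intro that[of l]) (simp add: tendsto_weakly_def)
qed

subsection \<open>Subspaces of finite codimension\<close>

definition finite_rank_map :: "(('a::real_normed_vector \<Rightarrow>\<^sub>L real) \<times> 'a) list \<Rightarrow> 'a \<Rightarrow> 'a" where
  "finite_rank_map ds x = (\<Sum>(g, v)\<leftarrow>ds. blinfun_apply g x *\<^sub>R v)"

lemma finite_rank_map_Nil [simp]: "finite_rank_map [] x = 0"
  by (simp add: finite_rank_map_def)

lemma finite_rank_map_Cons [simp]:
  "finite_rank_map ((g, v) # ds) x = blinfun_apply g x *\<^sub>R v + finite_rank_map ds x"
  by (simp add: finite_rank_map_def)

lemma bounded_linear_finite_rank_map: "bounded_linear (finite_rank_map ds)"
proof (induction ds)
  case Nil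
  show ?case by (simp add: bounded_linear_zero)
next
  case (Cons d ds)
  obtain g v where "d = (g, v)" by fastforce
  thus ?case
    using Cons.IH by (auto simp: fun_eq_iff intro!: bounded_linear_intros)
qed

lemma finite_rank_map_eq_0:
  "(\<And>g. g \<in> fst ` set ds \<Longrightarrow> blinfun_apply g x = 0) \<Longrightarrow> finite_rank_map ds x = 0"
  by (induction ds) (auto simp: finite_rank_map_def)

lemma tendsto_finite_rank_map:
  assumes "tendsto_weakly x 0 F"
  shows "((\<lambda>n. finite_rank_map ds (x n)) \<longlongrightarrow> 0) F"
proof (induction ds)
  case (Cons d ds)
  obtain g v where d: "d = (g, v)" by fastforce
  have "((\<lambda>n. blinfun_apply g (x n) *\<^sub>R v + finite_rank_map ds (x n)) \<longlongrightarrow> g 0 *\<^sub>R v + 0) F"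
    using assms Cons.IH by (intro tendsto_intros tendsto_weaklyD)
  thus ?case by (simp add: d)
qed simp

text \<open>The rank-one correction in the induction step removes the component along the image \<open>w\<close> of
  the new vector; no intermediate span has to be closed, so completeness is not needed.\<close>

lemma span_mod_closed_subspace_finite_rank:
  fixes E :: "'a::real_normed_vector set"
  assumes E: "subspace E" "closed E" and "finite S"
  shows "\<exists>ds. \<forall>x\<in>span (E \<union> S). x - finite_rank_map ds x \<in> E"
  using \<open>finite S\<close>
proof (induction S)
  case empty
  have "span (E \<union> {}) = E" using E(1) by simp
  thus ?case by (intro exI[of _ "[]"]) (simp only: finite_rank_map_Nil diff_zero, blast)
next
  case (insert v S)
  then obtain ds where ds: "\<And>x. x \<in> span (E \<union> S) \<Longrightarrow> x - finite_rank_map ds x \<in> E" by blast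
  let ?T = "finite_rank_map ds"
  note T = bounded_linear_finite_rank_map[of ds]
  define w where "w = v - ?T v"
  have decompose: "\<exists>c. (x - ?T x) - c *\<^sub>R w \<in> E" if x: "x \<in> span (E \<union> insert v S)" for x
  proof -
    obtain c where "x - c *\<^sub>R v \<in> span (E \<union> S)" using x by (auto simp: span_insert)
    hence "(x - c *\<^sub>R v) - ?T (x - c *\<^sub>R v) \<in> E" by (rule ds)
    also have "(x - c *\<^sub>R v) - ?T (x - c *\<^sub>R v) = (x - ?T x) - c *\<^sub>R w"
      by (simp add: w_def linear_simps(2,5)[OF T] algebra_simps)
    finally show ?thesis by blast
  qed
  show ?case
  proof (cases "w \<in> E")
    case True
    have "x - ?T x \<in> E" if x: "x \<in> span (E \<union> insert v S)" for x
      using decompose[OF x] subspace_scale[OF E(1) True] subspace_add[OF E(1)]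
      by (metis diff_add_cancel)
    thus ?thesis by blast
  next
    case False
    then obtain g :: "'a \<Rightarrow>\<^sub>L real" where g: "\<And>z. z \<in> E \<Longrightarrow> g z = 0" "g w = 1"
      using functional_separating_closed_subspace[OF E] by metis
    define h where "h = Blinfun (\<lambda>x. g (x - ?T x))"
    have h: "h x = g (x - ?T x)" for x
      unfolding h_def by (subst bounded_linear_Blinfun_apply) (intro bounded_linear_intros T, simp)
    have "x - finite_rank_map ((h, w) # ds) x \<in> E" if x: "x \<in> span (E \<union> insert v S)" for x
    proof -
      obtain c where c: "(x - ?T x) - c *\<^sub>R w \<in> E" using decompose[OF x] by blast
      hence "h x = c" using g(1)[OF c] g(2) by (simp add: h blinfun.diff_right blinfun.scaleR_right)
      thus ?thesis using c by (simp add: algebra_simps)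
    qed
    thus ?thesis by blast
  qed
qed

lemma fin_codim_finite_rank:
  assumes "fin_codim_subspace E"
  obtains ds where "\<And>x. x - finite_rank_map ds x \<in> E"
  using assms span_mod_closed_subspace_finite_rank[of E] unfolding fin_codim_subspace_def
  by (metis UNIV_I)

lemma fin_codim_subspace_UNIV: "fin_codim_subspace UNIV"
  by (auto simp: fin_codim_subspace_def intro!: exI[of _ "{}"])

lemma weakly_null_approx_in_fin_codim:
  fixes x :: "'b \<Rightarrow> 'a::real_normed_vector"
  assumes E: "fin_codim_subspace E" and x: "tendsto_weakly x 0 F" "\<And>n. norm (x n) \<le> 1"
  obtains h where "\<And>n. h n \<in> E" "\<And>n. norm (h n) \<le> 2" "((\<lambda>n. x n - h n) \<longlongrightarrow> 0) F"
proof -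
  obtain ds where ds: "\<And>z. z - finite_rank_map ds z \<in> E"
    using fin_codim_finite_rank[OF E] by blast
  let ?T = "finite_rank_map ds"
  define h where "h n = (if norm (x n - ?T (x n)) \<le> 2 then x n - ?T (x n) else 0)" for n
  have T: "((\<lambda>n. ?T (x n)) \<longlongrightarrow> 0) F" using x(1) by (rule tendsto_finite_rank_map)
  hence "\<forall>\<^sub>F n in F. norm (?T (x n)) < 1" using tendstoD[OF T, of 1] by simp
  hence "\<forall>\<^sub>F n in F. ?T (x n) = x n - h n"
  proof eventually_elim
    case (elim n)
    have "norm (x n - ?T (x n)) \<le> norm (x n) + norm (?T (x n))" by (rule norm_triangle_ineq4)
    thus ?case using elim x(2)[of n] by (simp add: h_def)
  qed
  hence "((\<lambda>n. x n - h n) \<longlongrightarrow> 0) F" using T by (rule Lim_transform_eventually[rotated])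
  moreover have "h n \<in> E" for n
    using ds E by (simp add: h_def fin_codim_subspace_def subspace_0)
  moreover have "norm (h n) \<le> 2" for n by (simp add: h_def)
  ultimately show ?thesis using that by blast
qed

lemma infinite_dimensional_common_kernel:
  fixes \<Phi> :: "('a::real_normed_vector \<Rightarrow>\<^sub>L real) set"
  assumes inf: "infinite_dimensional TYPE('a)" and "finite \<Phi>" and "finite B"
  shows "\<not> {x. \<forall>g\<in>\<Phi>. blinfun_apply g x = 0} \<subseteq> span B"
  using assms(2,3)
proof (induction \<Phi> arbitrary: B)
  case empty
  thus ?case using inf by (auto simp: infinite_dimensional_def)
next
  case (insert g \<Phi>)
  let ?S = "{x. \<forall>g\<in>\<Phi>. blinfun_apply g x = 0}" and ?S' = "{x. \<forall>h\<in>insert g \<Phi>. blinfun_apply h x = 0}"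
  show ?case
  proof
    assume sub: "?S' \<subseteq> span B"
    have "\<not> ?S \<subseteq> span B" using insert by blast
    then obtain s where s: "s \<in> ?S" "g s \<noteq> 0" using sub by blast
    have "x \<in> span (insert s B)" if "x \<in> ?S" for x
    proof -
      have "x - (g x / g s) *\<^sub>R s \<in> ?S'"
        using s that by (simp add: blinfun.diff_right blinfun.scaleR_right)
      thus ?thesis using sub by (auto simp: span_insert)
    qed
    thus False using insert.IH[of "insert s B"] insert.prems by blast
  qed
qed

lemma fin_codim_Inter_unit_vector:
  fixes \<E> :: "'a::real_normed_vector set set"
  assumes inf: "infinite_dimensional TYPE('a)" and "finite \<E>"
    and codim: "\<And>E. E \<in> \<E> \<Longrightarrow> fin_codim_subspace E"
  obtains x where "norm x = 1" "\<And>E. E \<in> \<E> \<Longrightarrow> x \<in> E"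
proof -
  have "\<exists>ds. \<forall>x. x - finite_rank_map ds x \<in> E" if "E \<in> \<E>" for E
    using fin_codim_finite_rank[OF codim[OF that]] by blast
  then obtain ds where ds: "\<And>E x. E \<in> \<E> \<Longrightarrow> x - finite_rank_map (ds E) x \<in> E" by metis
  let ?\<Phi> = "\<Union>E\<in>\<E>. fst ` set (ds E)"
  have "\<not> {x. \<forall>g\<in>?\<Phi>. blinfun_apply g x = 0} \<subseteq> span {}"
    using \<open>finite \<E>\<close> by (intro infinite_dimensional_common_kernel[OF inf]) auto
  then obtain x where x: "\<And>g. g \<in> ?\<Phi> \<Longrightarrow> g x = 0" "x \<noteq> 0" by auto
  have "x /\<^sub>R norm x \<in> E" if "E \<in> \<E>" for E
  proof -
    have "finite_rank_map (ds E) x = 0" using that x(1) by (intro finite_rank_map_eq_0) blast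
    hence "x \<in> E" using ds[OF that, of x] by simp
    thus ?thesis using codim[OF that] by (simp add: fin_codim_subspace_def subspace_scale)
  qed
  thus ?thesis using x(2) by (intro that[of "x /\<^sub>R norm x"]) auto
qed

subsection \<open>Asymptotic uniform smoothness\<close>

lemma norm_add_le_of_sphere:
  fixes E :: "'a::real_normed_vector set"
  assumes E: "subspace E" and "0 < t" "norm z \<le> B"
    and sphere: "\<And>u. u \<in> E \<Longrightarrow> norm u = t \<Longrightarrow> norm (z + u) \<le> B"
    and h: "h \<in> E" "norm h \<le> t"
  shows "norm (z + h) \<le> B"
proof (cases "h = 0")
  case False
  define u a where "u = (t / norm h) *\<^sub>R h" and "a = norm h / t"
  have "norm (z + u) \<le> B"
    using E h(1) \<open>0 < t\<close> False by (intro sphere) (simp_all add: u_def subspace_scale)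
  have a: "0 \<le> a" "a \<le> 1" using h \<open>0 < t\<close> by (auto simp: a_def)
  have "z + h = (1 - a) *\<^sub>R z + a *\<^sub>R (z + u)"
    using False \<open>0 < t\<close> by (simp add: a_def u_def algebra_simps)
  hence "norm (z + h) \<le> (1 - a) * norm z + a * norm (z + u)"
    using norm_triangle_ineq[of "(1 - a) *\<^sub>R z" "a *\<^sub>R (z + u)"] a by simp
  also have "\<dots> \<le> (1 - a) * B + a * B"
    using a \<open>norm z \<le> B\<close> \<open>norm (z + u) \<le> B\<close> by (intro add_mono mult_left_mono) auto
  finally show ?thesis by (simp add: algebra_simps)
qed (use assms in simp)

definition asym_norm_bound :: "'a::real_normed_vector \<Rightarrow> real \<Rightarrow> real \<Rightarrow> bool" where
  "asym_norm_bound s \<rho> B \<longleftrightarrow>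
     (\<exists>E. fin_codim_subspace E \<and> (\<forall>h\<in>E. norm h \<le> \<rho> \<longrightarrow> norm (s + h) \<le> B))"

lemma asym_norm_boundI:
  assumes "fin_codim_subspace E" "\<And>h. h \<in> E \<Longrightarrow> norm h \<le> \<rho> \<Longrightarrow> norm (s + h) \<le> B"
  shows "asym_norm_bound s \<rho> B"
  using assms unfolding asym_norm_bound_def by blast

lemma asym_norm_boundE:
  assumes "asym_norm_bound s \<rho> B"
  obtains E where "fin_codim_subspace E" "\<And>h. h \<in> E \<Longrightarrow> norm h \<le> \<rho> \<Longrightarrow> norm (s + h) \<le> B"
proof -
  obtain E where "fin_codim_subspace E" "\<forall>h\<in>E. norm h \<le> \<rho> \<longrightarrow> norm (s + h) \<le> B"
    using assms unfolding asym_norm_bound_def by blast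
  thus ?thesis by (intro that[of E]) simp_all
qed

lemma asym_norm_bound_mono: "asym_norm_bound s \<rho> B \<Longrightarrow> B \<le> B' \<Longrightarrow> asym_norm_bound s \<rho> B'"
  unfolding asym_norm_bound_def by (meson order_trans)

lemma asym_norm_bound_triangle:
  assumes "norm s + \<rho> \<le> B"
  shows "asym_norm_bound s \<rho> B"
  by (rule asym_norm_boundI[OF fin_codim_subspace_UNIV norm_triangle_le]) (use assms in simp)

lemma asym_norm_bound_scaleR:
  assumes bound: "asym_norm_bound s \<rho> B" and c: "0 < c"
  shows "asym_norm_bound (c *\<^sub>R s) (c * \<rho>) (c * B)"
proof -
  obtain E where E: "fin_codim_subspace E" "\<And>h. h \<in> E \<Longrightarrow> norm h \<le> \<rho> \<Longrightarrow> norm (s + h) \<le> B"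
    by (rule asym_norm_boundE[OF bound]) (rule that)
  have "norm (c *\<^sub>R s + h) \<le> c * B" if h: "h \<in> E" "norm h \<le> c * \<rho>" for h
  proof -
    have "norm (s + h /\<^sub>R c) \<le> B"
      using h c E(1)
      by (intro E(2)) (simp_all add: fin_codim_subspace_def subspace_scale field_simps)
    hence "c * norm (s + h /\<^sub>R c) \<le> c * B" using c by (intro mult_left_mono) auto
    also have "c * norm (s + h /\<^sub>R c) = norm (c *\<^sub>R (s + h /\<^sub>R c))"
      using c by (simp only: norm_scaleR abs_of_pos)
    also have "c *\<^sub>R (s + h /\<^sub>R c) = c *\<^sub>R s + h" using c by (simp add: scaleR_right_distrib)
    finally show ?thesis .
  qed
  with E(1) show ?thesis by (rule asym_norm_boundI)
qed

lemma asym_smooth_unit_vector: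
  assumes "asymptotically_uniformly_smooth_power TYPE('a::real_normed_vector) r"
  obtains C where "C \<ge> 1"
    "\<And>(z::'a) t. norm z = 1 \<Longrightarrow> 0 < t \<Longrightarrow> t \<le> 1 \<Longrightarrow> asym_norm_bound z t (1 + C * t powr r)"
proof -
  obtain C0 where C0: "\<And>t. t \<in> {0..1} \<Longrightarrow> asym_smooth_modulus TYPE('a) t \<le> ereal (C0 * t powr r)"
    using assms unfolding asymptotically_uniformly_smooth_power_def by blast
  define C where "C = max C0 0 + 1"
  have "asym_norm_bound z t (1 + C * t powr r)"
    if z: "norm z = 1" and t: "0 < t" "t \<le> 1" for z :: 'a and t
  proof -
    let ?S = "\<lambda>z E. SUP h\<in>{h\<in>E. norm h = 1}. ereal (norm (z + t *\<^sub>R h))"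
    have "(SUP z\<in>{z::'a. norm z = 1}. INF E\<in>{E. fin_codim_subspace E}. ?S z E) \<le> ereal (C0 * t powr r) + 1"
      using C0[of t] t unfolding asym_smooth_modulus_def by (simp add: ereal_minus_le)
    hence "(INF E\<in>{E. fin_codim_subspace E}. ?S z E) \<le> ereal (C0 * t powr r) + 1"
      using z by (auto simp: SUP_le_iff)
    also have "\<dots> < ereal (1 + C * t powr r)"
      using t by (simp add: one_ereal_def C_def add.commute mult_strict_right_mono)
    finally obtain E where E: "fin_codim_subspace E" "?S z E < ereal (1 + C * t powr r)"
      by (auto simp: INF_less_iff)
    have sphere: "norm (z + u) \<le> 1 + C * t powr r" if u: "u \<in> E" "norm u = t" for u
    proof -
      define w where "w = u /\<^sub>R t"
      have "w \<in> {h \<in> E. norm h = 1}"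
        using E(1) u t by (simp add: w_def fin_codim_subspace_def subspace_scale)
      hence "ereal (norm (z + t *\<^sub>R w)) \<le> ?S z E" by (rule SUP_upper)
      hence "ereal (norm (z + t *\<^sub>R w)) < ereal (1 + C * t powr r)"
        using E(2) by (rule order.strict_trans1)
      moreover have "t *\<^sub>R w = u" using t by (simp add: w_def)
      ultimately show ?thesis by (simp only: less_ereal.simps less_imp_le)
    qed
    have "norm (z + h) \<le> 1 + C * t powr r" if "h \<in> E" "norm h \<le> t" for h
      by (rule norm_add_le_of_sphere[OF _ t(1) _ sphere that])
        (use E(1) z in \<open>auto simp: fin_codim_subspace_def C_def\<close>)
    with E(1) show ?thesis by (rule asym_norm_boundI)
  qed
  thus ?thesis by (intro that[of C]) (auto simp: C_def)
qed

lemma asym_smooth_homogeneous: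
  assumes "asymptotically_uniformly_smooth_power TYPE('a::real_normed_vector) r"
  obtains C where "C \<ge> 1"
    "\<And>(s::'a) t. 0 < t \<Longrightarrow> t \<le> 1 \<Longrightarrow> asym_norm_bound s (t * norm s) ((1 + C * t powr r) * norm s)"
proof -
  obtain C where C: "C \<ge> 1"
    "\<And>(z::'a) t. norm z = 1 \<Longrightarrow> 0 < t \<Longrightarrow> t \<le> 1 \<Longrightarrow> asym_norm_bound z t (1 + C * t powr r)"
    using asym_smooth_unit_vector[OF assms] by blast
  have "asym_norm_bound s (t * norm s) ((1 + C * t powr r) * norm s)"
    if t: "0 < t" "t \<le> 1" for s :: 'a and t
  proof (cases "s = 0")
    case True
    thus ?thesis by (intro asym_norm_bound_triangle) simp
  next
    case False
    hence "norm (s /\<^sub>R norm s) = 1" by simp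
    hence "asym_norm_bound (s /\<^sub>R norm s) t (1 + C * t powr r)" using t by (rule C(2))
    from asym_norm_bound_scaleR[OF this, of "norm s"] show ?thesis
      using False by (simp add: mult.commute)
  qed
  with C(1) show ?thesis by (rule that)
qed

lemma one_plus_powr_le:
  fixes a x r :: real
  assumes "1 \<le> r" "0 \<le> a" "0 \<le> x" "x \<le> 1"
  shows "(1 + a * x) powr r \<le> 1 + (1 + a) powr r * x"
proof -
  have "((1 - x) *\<^sub>R 1 + x *\<^sub>R (1 + a)) powr r \<le> (1 - x) * 1 powr r + x * (1 + a) powr r"
    using assms by (intro convex_onD[OF powr_convex[OF assms(1)]]) auto
  moreover have "(1 - x) *\<^sub>R 1 + x *\<^sub>R (1 + a) = 1 + a * x" by (simp add: algebra_simps)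
  ultimately show ?thesis using assms(3) by (simp add: algebra_simps)
qed

lemma le_powr_inverse:
  fixes x r w :: real
  assumes "0 \<le> x" "0 < r" "x powr r \<le> w"
  shows "x \<le> w powr (1 / r)"
proof -
  have "x = (x powr r) powr (1 / r)" using assms by (simp add: powr_powr)
  also have "\<dots> \<le> w powr (1 / r)" using assms by (intro powr_mono2) auto
  finally show ?thesis .
qed

lemma powr_le_of_le_powr_inverse:
  fixes x r w :: real
  assumes "0 \<le> x" "0 < r" "0 \<le> w" "x \<le> w powr (1 / r)"
  shows "x powr r \<le> w"
proof -
  have "x powr r \<le> (w powr (1 / r)) powr r" using assms by (intro powr_mono2) auto
  also have "\<dots> = w" using assms by (simp add: powr_powr)
  finally show ?thesis .
qed

lemma one_plus_mult_powr_le: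
  fixes C N r t :: real
  assumes r: "1 \<le> r" and "0 \<le> C" "0 \<le> t" "t \<le> N" "0 < N"
  shows "((1 + C * (t / N) powr r) * N) powr r \<le> N powr r + (1 + C) powr r * t powr r"
proof -
  define x where "x = (t / N) powr r"
  have "t / N \<le> 1" using assms by simp
  hence x: "0 \<le> x" "x \<le> 1" using assms by (auto simp: x_def intro: powr_le1)
  have x_scaled: "x * N powr r = t powr r"
    using assms(5) unfolding x_def powr_mult[symmetric] by simp
  have "((1 + C * x) * N) powr r = (1 + C * x) powr r * N powr r" by (rule powr_mult)
  also have "\<dots> \<le> (1 + (1 + C) powr r * x) * N powr r"
    using assms(2) r x by (intro mult_right_mono one_plus_powr_le) auto
  also have "\<dots> = N powr r + (1 + C) powr r * t powr r"
    using x_scaled by (simp add: algebra_simps)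
  finally show ?thesis unfolding x_def .
qed

lemma asym_smooth_powr_step:
  assumes smooth: "asymptotically_uniformly_smooth_power TYPE('a::real_normed_vector) r"
    and r: "1 \<le> r"
  obtains C where "C > 0" "\<And>s::'a. asym_norm_bound s 2 ((norm s powr r + C) powr (1 / r))"
proof -
  obtain C where C: "C \<ge> 1"
    "\<And>(s::'a) t. 0 < t \<Longrightarrow> t \<le> 1 \<Longrightarrow> asym_norm_bound s (t * norm s) ((1 + C * t powr r) * norm s)"
    using asym_smooth_homogeneous[OF smooth] by blast
  define K where "K = 4 powr r + (1 + C) powr r * 2 powr r"
  have K: "4 powr r \<le> K" "(1 + C) powr r * 2 powr r \<le> K" "0 < K"
    by (simp_all add: K_def add_pos_nonneg)
  have "asym_norm_bound s 2 ((norm s powr r + K) powr (1 / r))" for s :: 'a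
  proof (cases "norm s < 2")
    case True
    have "4 powr r \<le> norm s powr r + K" using K(1) powr_ge_zero[of "norm s" r] by linarith
    hence "4 \<le> (norm s powr r + K) powr (1 / r)" using r by (intro le_powr_inverse) auto
    thus ?thesis using True by (intro asym_norm_bound_triangle) linarith
  next
    case False
    hence s: "2 \<le> norm s" "0 < norm s" by linarith+
    let ?B = "(1 + C * (2 / norm s) powr r) * norm s"
    have "asym_norm_bound s 2 ?B" using C(2)[of "2 / norm s" s] s by auto
    moreover have "?B \<le> (norm s powr r + K) powr (1 / r)"
    proof (rule le_powr_inverse)
      have "?B powr r \<le> norm s powr r + (1 + C) powr r * 2 powr r"
        using r C(1) s by (intro one_plus_mult_powr_le) auto
      thus "?B powr r \<le> norm s powr r + K" using K(2) by linarith
    qed (use C(1) r in auto)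
    ultimately show ?thesis by (rule asym_norm_bound_mono)
  qed
  with K(3) show ?thesis by (rule that)
qed

definition weak_upper_estimate :: "'a::real_normed_vector itself \<Rightarrow> real \<Rightarrow> real \<Rightarrow> bool" where
  "weak_upper_estimate _ r C \<longleftrightarrow>
     (\<forall>F (s::'a) d::nat \<Rightarrow> 'a. tendsto_weakly d 0 F \<longrightarrow> (\<forall>n. norm (d n) \<le> 1) \<longrightarrow>
        (\<forall>\<^sub>F n in F. norm (s + d n) powr r \<le> norm s powr r + C))"

lemma asym_smooth_imp_weak_upper_estimate:
  assumes "asymptotically_uniformly_smooth_power TYPE('a::real_normed_vector) r" and r: "1 \<le> r"
  obtains C where "C > 0" "weak_upper_estimate TYPE('a) r C"
proof -
  obtain C where C: "C > 0" "\<And>s::'a. asym_norm_bound s 2 ((norm s powr r + C) powr (1 / r))"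
    using asym_smooth_powr_step[OF assms] by blast
  have "\<forall>\<^sub>F n in F. norm (s + d n) powr r \<le> norm s powr r + (C + 1)"
    if d: "tendsto_weakly d 0 F" "\<And>n. norm (d n) \<le> 1" for F and s :: 'a and d :: "nat \<Rightarrow> 'a"
  proof -
    define b where "b c = (norm s powr r + c) powr (1 / r)" for c
    have "asym_norm_bound s 2 (b C)" unfolding b_def by (rule C(2))
    then obtain E where E: "fin_codim_subspace E" "\<And>h. h \<in> E \<Longrightarrow> norm h \<le> 2 \<Longrightarrow> norm (s + h) \<le> b C"
      by (rule asym_norm_boundE) (rule that)
    obtain h where h: "\<And>n. h n \<in> E" "\<And>n. norm (h n) \<le> 2" "((\<lambda>n. d n - h n) \<longlongrightarrow> 0) F"
      using weakly_null_approx_in_fin_codim[OF E(1) d] by blast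
    have "b C < b (C + 1)"
      unfolding b_def using r C(1) by (intro powr_less_mono2) (auto simp: add_nonneg_pos)
    hence "\<forall>\<^sub>F n in F. norm (d n - h n) < b (C + 1) - b C"
      using tendstoD[OF h(3), of "b (C + 1) - b C"] by simp
    thus ?thesis
    proof eventually_elim
      case (elim n)
      have "norm (s + d n) \<le> b (C + 1)"
        using norm_triangle_ineq[of "s + h n" "d n - h n"] E(2)[OF h(1,2), of n] elim by simp
      thus ?case
        using r C(1) unfolding b_def by (intro powr_le_of_le_powr_inverse) auto
    qed
  qed
  thus ?thesis using C(1) by (intro that[of "C + 1"]) (auto simp: weak_upper_estimate_def)
qed

lemma weak_upper_estimate_iter_filter:
  fixes x :: "nat \<Rightarrow> 'a::real_normed_vector"
  assumes upper: "weak_upper_estimate TYPE('a) r C"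
    and x: "tendsto_weakly x 0 F" "\<And>n. norm (x n) \<le> 1"
  shows "\<forall>\<^sub>F l in iter_filter F k. norm (s + (\<Sum>n\<leftarrow>l. x n)) powr r \<le> norm s powr r + real k * C"
proof (induction k arbitrary: s)
  case (Suc k)
  have "\<forall>\<^sub>F n in F. norm (s + x n) powr r \<le> norm s powr r + C"
    using upper x by (simp add: weak_upper_estimate_def)
  hence "\<forall>\<^sub>F n in F. \<forall>\<^sub>F l in iter_filter F k.
      norm (s + (\<Sum>m\<leftarrow>n # l. x m)) powr r \<le> norm s powr r + real (Suc k) * C"
  proof eventually_elim
    case (elim n)
    show ?case using Suc.IH[of "s + x n"]
      by eventually_elim (use elim in \<open>auto simp: algebra_simps\<close>)
  qed
  thus ?case by simp
qed simp

lemma weak_upper_estimate_sum_list_bound: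
  fixes x :: "nat \<Rightarrow> 'a::real_normed_vector"
  assumes "weak_upper_estimate TYPE('a) r C" "tendsto_weakly x 0 F" "\<And>n. norm (x n) \<le> 1" and "0 < r"
  shows "\<forall>\<^sub>F l in iter_filter F k. norm (\<Sum>n\<leftarrow>l. x n) \<le> (real k * C) powr (1 / r)"
  using weak_upper_estimate_iter_filter[OF assms(1-3), where s = 0]
  by eventually_elim (use \<open>0 < r\<close> in \<open>auto intro: le_powr_inverse\<close>)

text \<open>The Kalton--Randrianarivony concentration inequality. Successive weak limits along the
  ultrafilter split \<open>G\<close> into martingale-like differences.\<close>

lemma reflexive_concentration:
  fixes G :: "nat list \<Rightarrow> 'a::real_normed_vector"
  assumes refl: "reflexive TYPE('a)" and U: "ultrafilter U"
    and upper: "weak_upper_estimate TYPE('a) r C"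
    and lip: "\<And>xs n m ys. length xs + length ys + 1 = k \<Longrightarrow> norm (G (xs @ n # ys) - G (xs @ m # ys)) \<le> 1"
  shows "\<exists>y. tendsto_weakly G y (iter_filter U k) \<and>
      (\<forall>s. \<forall>\<^sub>F l in iter_filter U k. norm (s + (G l - y)) powr r \<le> norm s powr r + real k * C)"
  using lip
proof (induction k arbitrary: G)
  case 0
  show ?case by (intro exI[of _ "G []"]) (auto simp: tendsto_weakly_def tendsto_iff)
next
  case (Suc k)
  have "U \<noteq> bot" using U by (simp add: ultrafilter_def)
  have "\<exists>y. tendsto_weakly (\<lambda>l. G (n # l)) y (iter_filter U k) \<and>
      (\<forall>s. \<forall>\<^sub>F l in iter_filter U k. norm (s + (G (n # l) - y)) powr r \<le> norm s powr r + real k * C)" for n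
    using Suc.prems[of "n # xs" for xs] by (intro Suc.IH) simp
  then obtain y where y: "\<And>n. tendsto_weakly (\<lambda>l. G (n # l)) (y n) (iter_filter U k)"
    and conc: "\<And>n s. \<forall>\<^sub>F l in iter_filter U k.
      norm (s + (G (n # l) - y n)) powr r \<le> norm s powr r + real k * C"
    by metis
  have y_diff: "norm (y n - y m) \<le> 1" for n m
  proof (rule norm_tendsto_weakly_le[OF tendsto_weakly_diff[OF y[of n] y[of m]]])
    show "\<forall>\<^sub>F l in iter_filter U k. norm (G (n # l) - G (m # l)) \<le> 1"
      using eventually_iter_filter_length by eventually_elim (use Suc.prems[of "[]"] in simp)
  qed (use iter_filter_neq_bot[OF \<open>U \<noteq> bot\<close>] in simp)
  have "norm (y n) \<le> norm (y 0) + 1" for n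
    using y_diff[of n 0] norm_triangle_ineq2[of "y n" "y 0"] by linarith
  then obtain z where z: "tendsto_weakly y z U"
    using reflexive_bounded_weak_limit[OF refl U] by blast
  have "tendsto_weakly (\<lambda>n. y n - z) 0 U"
    using tendsto_weakly_diff[OF z tendsto_imp_tendsto_weakly[OF tendsto_const[of z]]] by simp
  moreover have "norm (y n - z) \<le> 1" for n
    using norm_tendsto_weakly_le[OF tendsto_weakly_diff[OF tendsto_imp_tendsto_weakly[OF tendsto_const] z]
        \<open>U \<noteq> bot\<close>, of "y n" 1] y_diff by simp
  ultimately have step: "\<forall>\<^sub>F n in U. norm (s + (y n - z)) powr r \<le> norm s powr r + C" for s
    using upper by (simp add: weak_upper_estimate_def)
  have "\<forall>\<^sub>F n in U. \<forall>\<^sub>F l in iter_filter U k.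
      norm (s + (G (n # l) - z)) powr r \<le> norm s powr r + real (Suc k) * C" for s
    using step[of s]
  proof eventually_elim
    case (elim n)
    show ?case using conc[of "s + (y n - z)" n]
      by eventually_elim (use elim in \<open>simp add: algebra_simps\<close>)
  qed
  thus ?case using tendsto_weakly_iter_filter_Suc[OF y z] by auto
qed

subsection \<open>Weakly null sequences\<close>

lemma upper_estimate_functional_finite:
  fixes x :: "nat \<Rightarrow> 'a::real_normed_vector" and g :: "'a \<Rightarrow>\<^sub>L real"
  assumes p: "p > 1" and upper: "\<And>A. finite A \<Longrightarrow> norm (\<Sum>n\<in>A. x n) powr p \<le> real (card A) * C"
    and "\<delta> > 0"
  shows "finite {n. \<delta> \<le> g (x n)}"
proof -
  define M where "M = norm g * C powr (1 / p) / \<delta>"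
  have "real (card A) \<le> M powr (1 / (1 - 1 / p))" if A: "A \<subseteq> {n. \<delta> \<le> g (x n)}" "finite A" for A
  proof (cases "A = {}")
    case False
    define a where "a = real (card A)"
    have a: "a > 0" using False A(2) by (simp add: a_def card_gt_0_iff)
    have "a * \<delta> \<le> (\<Sum>n\<in>A. g (x n))" using A by (simp add: a_def sum_bounded_below subset_iff)
    also have "\<dots> = g (\<Sum>n\<in>A. x n)" by (simp add: blinfun.sum_right)
    also have "\<dots> \<le> norm g * norm (\<Sum>n\<in>A. x n)" using norm_blinfun[of g "\<Sum>n\<in>A. x n"] by simp
    also have "\<dots> \<le> norm g * (a * C) powr (1 / p)"
      using upper[OF A(2)] p by (intro mult_left_mono le_powr_inverse) (auto simp: a_def)
    also have "\<dots> = norm g * C powr (1 / p) * a powr (1 / p)" by (simp add: powr_mult)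
    finally have "a / a powr (1 / p) \<le> M" using a \<open>\<delta> > 0\<close> by (simp add: M_def field_simps)
    hence "a powr (1 - 1 / p) \<le> M" using a by (simp add: powr_diff)
    thus ?thesis using a p by (intro le_powr_inverse) (auto simp: a_def)
  qed simp
  hence "card A \<le> nat \<lfloor>M powr (1 / (1 - 1 / p))\<rfloor>" if "A \<subseteq> {n. \<delta> \<le> g (x n)}" "finite A" for A
    using that by (intro le_nat_floor)
  thus ?thesis by (intro finite_if_finite_subsets_card_bdd[THEN conjunct1])
qed

lemma upper_estimate_imp_weakly_null:
  fixes x :: "nat \<Rightarrow> 'a::real_normed_vector"
  assumes "p > 1" and "\<And>A. finite A \<Longrightarrow> norm (\<Sum>n\<in>A. x n) powr p \<le> real (card A) * C"
  shows "weakly_null x"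
  unfolding weakly_null_def
proof (intro allI tendstoI)
  fix g :: "'a \<Rightarrow>\<^sub>L real" and \<delta> :: real assume "\<delta> > 0"
  note finite_level = upper_estimate_functional_finite[OF assms \<open>\<delta> > 0\<close>]
  have "{n. \<not> dist (g (x n)) 0 < \<delta>} \<subseteq> {n. \<delta> \<le> g (x n)} \<union> {n. \<delta> \<le> (- g) (x n)}"
    by (auto simp: uminus_blinfun.rep_eq dist_real_def)
  moreover have "finite ({n. \<delta> \<le> g (x n)} \<union> {n. \<delta> \<le> (- g) (x n)})"
    using finite_level by blast
  ultimately have "finite {n. \<not> dist (g (x n)) 0 < \<delta>}" by (rule finite_subset)
  thus "\<forall>\<^sub>F n in sequentially. dist (g (x n)) 0 < \<delta>"
    by (simp add: eventually_cofinite flip: cofinite_eq_sequentially)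
qed

lemma asym_smooth_upper_estimate_sequence:
  assumes inf: "infinite_dimensional TYPE('a::real_normed_vector)"
    and smooth: "asymptotically_uniformly_smooth_power TYPE('a::real_normed_vector) p"
    and p: "1 \<le> p"
  obtains x :: "nat \<Rightarrow> 'a::real_normed_vector" and C where "\<And>n. norm (x n) = 1"
    "\<And>A. finite A \<Longrightarrow> norm (\<Sum>n\<in>A. x n) powr p \<le> real (card A) * C"
proof -
  obtain C where C: "C > 0" "\<And>s::'a. asym_norm_bound s 2 ((norm s powr p + C) powr (1 / p))"
    using asym_smooth_powr_step[OF smooth p] by blast
  have "\<exists>E. \<forall>s::'a. fin_codim_subspace (E s) \<and>
      (\<forall>h\<in>E s. norm h \<le> 2 \<longrightarrow> norm (s + h) \<le> (norm s powr p + C) powr (1 / p))"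
    using C(2) unfolding asym_norm_bound_def by (intro choice allI)
  then obtain E where E: "\<And>s::'a. fin_codim_subspace (E s)"
    and bound: "\<And>s h. h \<in> E s \<Longrightarrow> norm h \<le> 2 \<Longrightarrow> norm (s + h) \<le> (norm s powr p + C) powr (1 / p)"
    by blast
  define admissible where "admissible x n v \<longleftrightarrow> norm v = 1 \<and> (\<forall>A\<subseteq>{..<n}. v \<in> E (\<Sum>i\<in>A. x i))"
    for x :: "nat \<Rightarrow> 'a" and n :: nat and v
  have "\<exists>x. \<forall>n. admissible x n (x n)"
  proof (rule dependent_wellorder_choice)
    fix v :: 'a and x y :: "nat \<Rightarrow> 'a" and n assume "\<And>i. i < n \<Longrightarrow> x i = y i"
    hence "(\<Sum>i\<in>A. x i) = (\<Sum>i\<in>A. y i)" if "A \<subseteq> {..<n}" for A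
      using that by (intro sum.cong) auto
    thus "admissible x n v = admissible y n v" by (simp add: admissible_def)
  next
    fix n and x :: "nat \<Rightarrow> 'a"
    let ?\<E> = "(\<lambda>A. E (\<Sum>i\<in>A. x i)) ` Pow {..<n}"
    have "finite ?\<E>" "\<And>D. D \<in> ?\<E> \<Longrightarrow> fin_codim_subspace D" using E by auto
    then obtain v where v: "norm v = 1" "\<And>D. D \<in> ?\<E> \<Longrightarrow> v \<in> D"
      using fin_codim_Inter_unit_vector[OF inf] by metis
    have "v \<in> E (\<Sum>i\<in>A. x i)" if "A \<subseteq> {..<n}" for A using that by (intro v(2)) auto
    thus "\<exists>v. admissible x n v" using v(1) unfolding admissible_def by blast
  qed
  then obtain x where admissible: "admissible x n (x n)" for n by blast
  hence norm_x: "norm (x n) = 1" for n by (simp add: admissible_def)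
  have mem: "x n \<in> E (\<Sum>i\<in>A. x i)" if "A \<subseteq> {..<n}" for n A
    using admissible[of n] that by (simp add: admissible_def)
  have "norm (\<Sum>n\<in>A. x n) powr p \<le> real (card A) * C" if "finite A" for A
    using that
  proof (induction A rule: finite_linorder_max_induct)
    case (insert n A)
    have "n \<notin> A" "A \<subseteq> {..<n}" using insert.hyps by auto
    have "norm ((\<Sum>i\<in>A. x i) + x n) \<le> (norm (\<Sum>i\<in>A. x i) powr p + C) powr (1 / p)"
      using norm_x by (intro bound mem[OF \<open>A \<subseteq> {..<n}\<close>]) simp
    hence "norm ((\<Sum>i\<in>A. x i) + x n) powr p \<le> norm (\<Sum>i\<in>A. x i) powr p + C"
      using p C(1) by (intro powr_le_of_le_powr_inverse) auto
    also have "\<dots> \<le> real (card A) * C + C" using insert.IH by simp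
    finally show ?case
      using \<open>n \<notin> A\<close> insert.hyps(1) by (simp add: algebra_simps)
  qed simp
  thus ?thesis using norm_x that by blast
qed

lemma co_banach_saks_spreading_sequence:
  assumes "infinite_dimensional TYPE('a::real_normed_vector)"
    and "asymptotically_uniformly_smooth_power TYPE('a::real_normed_vector) p" and "p > 1"
    and cbs: "co_banach_saks TYPE('a::real_normed_vector) p"
  obtains x :: "nat \<Rightarrow> 'a::real_normed_vector" and c
    where "\<And>n. norm (x n) = 1" "weakly_null x" "c > 0"
    "\<And>A. finite A \<Longrightarrow> (\<And>j. j \<in> A \<Longrightarrow> card A \<le> j) \<Longrightarrow>
       c * real (card A) powr (1 / p) \<le> norm (\<Sum>j\<in>A. x j)"
proof -
  obtain x :: "nat \<Rightarrow> 'a::real_normed_vector" and C where x: "\<And>n. norm (x n) = 1"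
    and upper: "\<And>A. finite A \<Longrightarrow> norm (\<Sum>n\<in>A. x n) powr p \<le> real (card A) * C"
    using asym_smooth_upper_estimate_sequence[OF assms(1,2) less_imp_le[OF \<open>p > 1\<close>]] by blast
  have null: "weakly_null x" using \<open>p > 1\<close> upper by (rule upper_estimate_imp_weakly_null)
  have "semi_normalized x" unfolding semi_normalized_def using x by (intro exI[of _ 1]) auto
  then obtain \<sigma> c where \<sigma>: "strict_mono \<sigma>" "c > 0"
    "\<And>A. finite A \<Longrightarrow> (\<forall>j\<in>A. card A \<le> j) \<Longrightarrow>
       c * real (card A) powr (1 / p) \<le> norm (\<Sum>j\<in>A. x (\<sigma> j))"
    using cbs[unfolded co_banach_saks_def, rule_format, of x] null by blast
  have "weakly_null (\<lambda>n. x (\<sigma> n))"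
    using null tendsto_weakly_compose[OF _ filterlim_subseq[OF \<sigma>(1)]]
    by (simp add: weakly_null_iff_tendsto_weakly)
  thus ?thesis using x \<sigma> by (intro that[of "\<lambda>n. x (\<sigma> n)" c]) auto
qed

lemma spreading_sequence_in_fin_codim:
  fixes x :: "nat \<Rightarrow> 'a::real_normed_vector" and E :: "'a set"
  assumes x: "\<And>n. norm (x n) = 1" "weakly_null x" and "c > 0" and "k > 0"
    and lower: "\<And>A. finite A \<Longrightarrow> (\<And>j. j \<in> A \<Longrightarrow> card A \<le> j) \<Longrightarrow>
       c * real (card A) powr (1 / p) \<le> norm (\<Sum>j\<in>A. x j)"
    and F: "F \<le> sequentially" and E: "fin_codim_subspace E"
  obtains y where "y \<in> weakly_null_unit_seqs F E"
    "\<forall>\<^sub>F l in iter_filter F k. c / 4 * real k powr (1 / p) \<le> norm (\<Sum>n\<leftarrow>l. y n)"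
proof -
  have null: "tendsto_weakly x 0 F"
    using x(2) F by (auto simp: weakly_null_iff_tendsto_weakly intro: tendsto_weakly_mono)
  obtain h where h: "\<And>n. h n \<in> E" "\<And>n. norm (h n) \<le> 2" "((\<lambda>n. x n - h n) \<longlongrightarrow> 0) F"
    using weakly_null_approx_in_fin_codim[OF E null eq_refl[OF x(1)]] by blast
  define y where "y n = (1 / 2) *\<^sub>R h n" for n
  define \<kappa> where "\<kappa> = real k powr (1 / p)"
  have "tendsto_weakly (\<lambda>n. x n - (x n - h n)) (0 - 0) F"
    by (intro tendsto_weakly_diff null tendsto_imp_tendsto_weakly h(3))
  hence "tendsto_weakly y 0 F"
    unfolding y_def using tendsto_weakly_scaleR[of h 0 F "1 / 2"] by simp
  hence y: "y \<in> weakly_null_unit_seqs F E"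
    using h(1,2) E by (simp add: weakly_null_unit_seqs_def y_def fin_codim_subspace_def subspace_scale)
  have "\<forall>\<^sub>F l in iter_filter F k. \<forall>j\<in>set l. k \<le> j"
    by (intro eventually_iter_filter_set filter_leD[OF F] eventually_ge_at_top)
  moreover have "\<forall>\<^sub>F l in iter_filter F k. distinct l"
    using F by (intro eventually_iter_filter_distinct) (simp add: cofinite_eq_sequentially)
  moreover have "\<forall>\<^sub>F l in iter_filter F k. norm (\<Sum>n\<leftarrow>l. x n - h n) < c / 2 * \<kappa>"
    using tendstoD[OF tendsto_iter_filter_sum_list[OF h(3)], of "c / 2 * \<kappa>" k] \<open>c > 0\<close> \<open>k > 0\<close>
    by (simp add: \<kappa>_def)
  ultimately have "\<forall>\<^sub>F l in iter_filter F k. c / 4 * \<kappa> \<le> norm (\<Sum>n\<leftarrow>l. y n)"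
    using eventually_iter_filter_length
  proof eventually_elim
    case (elim l)
    hence "card (set l) = k" by (simp add: distinct_card)
    hence "c * \<kappa> \<le> norm (\<Sum>n\<in>set l. x n)" using lower[of "set l"] elim(1) by (simp add: \<kappa>_def)
    also have "(\<Sum>n\<in>set l. x n) = (\<Sum>n\<leftarrow>l. x n)"
      using elim(2) by (simp add: sum_list_distinct_conv_sum_set)
    also have "\<dots> = 2 *\<^sub>R (\<Sum>n\<leftarrow>l. y n) + (\<Sum>n\<leftarrow>l. x n - h n)"
      by (induction l) (simp_all add: y_def scaleR_right_distrib)
    also have "norm \<dots> \<le> 2 * norm (\<Sum>n\<leftarrow>l. y n) + c / 2 * \<kappa>"
      using norm_triangle_ineq[of "2 *\<^sub>R (\<Sum>n\<leftarrow>l. y n)" "\<Sum>n\<leftarrow>l. x n - h n"] elim(3) by simp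
    finally show ?case by simp
  qed
  with y show ?thesis unfolding \<kappa>_def by (rule that)
qed

text \<open>The constant must not depend on \<open>E\<close>: in the main argument \<open>E\<close> is found only after all
  parameters have been fixed.\<close>

definition uniformly_spreading :: "'a::real_normed_vector itself \<Rightarrow> nat filter \<Rightarrow> real \<Rightarrow> real \<Rightarrow> bool"
  where
  "uniformly_spreading _ F p c \<longleftrightarrow>
     (\<forall>(E::'a set) k. fin_codim_subspace E \<longrightarrow> 0 < k \<longrightarrow>
        (\<exists>y\<in>weakly_null_unit_seqs F E.
           \<forall>\<^sub>F l in iter_filter F k. c * real k powr (1 / p) \<le> norm (\<Sum>n\<leftarrow>l. y n)))"

lemma co_banach_saks_imp_uniformly_spreading:
  assumes "infinite_dimensional TYPE('a::real_normed_vector)"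
    and "asymptotically_uniformly_smooth_power TYPE('a::real_normed_vector) p" and "p > 1"
    and "co_banach_saks TYPE('a::real_normed_vector) p" and F: "F \<le> sequentially"
  obtains c where "c > 0" "uniformly_spreading TYPE('a::real_normed_vector) F p c"
proof -
  obtain x :: "nat \<Rightarrow> 'a" and c where x: "\<And>n. norm (x n) = 1" "weakly_null x" and "c > 0"
    and lower: "\<And>A. finite A \<Longrightarrow> (\<And>j. j \<in> A \<Longrightarrow> card A \<le> j) \<Longrightarrow>
       c * real (card A) powr (1 / p) \<le> norm (\<Sum>j\<in>A. x j)"
    using co_banach_saks_spreading_sequence[OF assms(1-4)] by blast
  have "uniformly_spreading TYPE('a) F p (c / 4)"
    unfolding uniformly_spreading_def
  proof (intro allI impI)
    fix E :: "'a set" and k :: nat assume "fin_codim_subspace E" "0 < k"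
    thus "\<exists>y\<in>weakly_null_unit_seqs F E.
        \<forall>\<^sub>F l in iter_filter F k. c / 4 * real k powr (1 / p) \<le> norm (\<Sum>n\<leftarrow>l. y n)"
      using spreading_sequence_in_fin_codim[OF x \<open>c > 0\<close> _ lower F] by metis
  qed
  thus ?thesis using \<open>c > 0\<close> by (intro that[of "c / 4"]) auto
qed

subsection \<open>Approximate midpoints\<close>

definition approx_midpoints :: "'a::metric_space \<Rightarrow> 'a \<Rightarrow> real \<Rightarrow> 'a set" where
  "approx_midpoints x y \<delta> =
     {z. dist x z \<le> (1 + \<delta>) / 2 * dist x y \<and> dist y z \<le> (1 + \<delta>) / 2 * dist x y}"

lemma midpoint_add_in_approx_midpoints_iff:
  fixes x y :: "'a::real_normed_vector"
  defines "w \<equiv> (1 / 2) *\<^sub>R (x - y)"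
  shows "midpoint x y + v \<in> approx_midpoints x y \<delta> \<longleftrightarrow>
    norm (w - v) \<le> (1 + \<delta>) * norm w \<and> norm (w + v) \<le> (1 + \<delta>) * norm w"
proof -
  have "x - (midpoint x y + v) = w - v" "y - (midpoint x y + v) = - (w + v)"
    by (simp_all add: w_def midpoint_def algebra_simps flip: scaleR_left_distrib)
  hence "dist x (midpoint x y + v) = norm (w - v)" "dist y (midpoint x y + v) = norm (w + v)"
    by (simp_all only: dist_norm norm_minus_cancel)
  moreover have "dist x y = 2 * norm w" by (simp add: w_def dist_norm)
  ultimately show ?thesis by (simp add: approx_midpoints_def)
qed

lemma asym_smooth_approx_midpoints:
  assumes "asymptotically_uniformly_smooth_power TYPE('a::real_normed_vector) p"
  obtains C where "C \<ge> 1"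
    "\<And>(x::'a) y t. 0 < t \<Longrightarrow> t \<le> 1 \<Longrightarrow> \<exists>E. fin_codim_subspace E \<and>
       (+) (midpoint x y) ` (E \<inter> cball 0 (t * dist x y / 2)) \<subseteq> approx_midpoints x y (C * t powr p)"
proof -
  obtain C where C: "C \<ge> 1"
    "\<And>(s::'a) t. 0 < t \<Longrightarrow> t \<le> 1 \<Longrightarrow> asym_norm_bound s (t * norm s) ((1 + C * t powr p) * norm s)"
    using asym_smooth_homogeneous[OF assms] by blast
  have "\<exists>E. fin_codim_subspace E \<and>
      (+) (midpoint x y) ` (E \<inter> cball 0 (t * dist x y / 2)) \<subseteq> approx_midpoints x y (C * t powr p)"
    if t: "0 < t" "t \<le> 1" for x y :: 'a and t
  proof -
    define w where "w = (1 / 2) *\<^sub>R (x - y)"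
    obtain E where E: "fin_codim_subspace E"
      "\<And>h. h \<in> E \<Longrightarrow> norm h \<le> t * norm w \<Longrightarrow> norm (w + h) \<le> (1 + C * t powr p) * norm w"
      by (rule asym_norm_boundE[OF C(2)[OF t, of w]]) (rule that)
    have "midpoint x y + h \<in> approx_midpoints x y (C * t powr p)"
      if h: "h \<in> E" "norm h \<le> t * dist x y / 2" for h
    proof -
      have "norm h \<le> t * norm w" using h(2) by (simp add: w_def dist_norm)
      moreover have "- h \<in> E" using E(1) h(1) by (simp add: fin_codim_subspace_def subspace_neg)
      ultimately have "norm (w - h) \<le> (1 + C * t powr p) * norm w"
        "norm (w + h) \<le> (1 + C * t powr p) * norm w"
        using E(2)[of "- h"] E(2)[of h] h(1) by simp_all
      thus ?thesis unfolding midpoint_add_in_approx_midpoints_iff w_def by (rule conjI)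
    qed
    thus ?thesis using E(1) by (intro exI[of _ E]) (simp add: image_subset_iff)
  qed
  thus ?thesis using C(1) by (rule that[rotated])
qed

definition has_finite_net :: "'a::metric_space set \<Rightarrow> real \<Rightarrow> bool" where
  "has_finite_net S \<rho> \<longleftrightarrow> (\<exists>A. finite A \<and> S \<subseteq> (\<Union>a\<in>A. cball a \<rho>))"

lemma has_finite_net_mono:
  assumes "has_finite_net T \<rho>" "S \<subseteq> T" "\<rho> \<le> \<rho>'"
  shows "has_finite_net S \<rho>'"
proof -
  obtain A where A: "finite A" "T \<subseteq> (\<Union>a\<in>A. cball a \<rho>)"
    using assms(1) unfolding has_finite_net_def by blast
  note \<open>S \<subseteq> T\<close>
  also note A(2)
  also have "(\<Union>a\<in>A. cball a \<rho>) \<subseteq> (\<Union>a\<in>A. cball a \<rho>')"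
    using assms(3) by (intro UN_mono subset_cball order_refl)
  finally show ?thesis unfolding has_finite_net_def using A(1) by (intro exI conjI)
qed

definition basis_proj :: "(nat \<Rightarrow> 'a::real_normed_vector) \<Rightarrow> nat \<Rightarrow> 'a \<Rightarrow> 'a" where
  "basis_proj e N y = (\<Sum>i<N. basis_coeffs e y i *\<^sub>R e i)"

lemma basis_coeffs_unique:
  assumes "schauder_basis e" "(\<lambda>n. \<Sum>i<n. a i *\<^sub>R e i) \<longlonglongrightarrow> y"
  shows "basis_coeffs e y = a"
  unfolding basis_coeffs_def
  by (rule the1_equality) (use assms in \<open>simp_all add: schauder_basis_def\<close>)

lemma basis_proj_tendsto:
  assumes "schauder_basis e"
  shows "(\<lambda>n. basis_proj e n y) \<longlonglongrightarrow> y"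
  unfolding basis_coeffs_def basis_proj_def
  by (rule theI'[where P = "\<lambda>a. (\<lambda>n. \<Sum>i<n. a i *\<^sub>R e i) \<longlonglongrightarrow> y"])
    (use assms in \<open>simp add: schauder_basis_def\<close>)

lemma basis_proj_approx:
  assumes e: "schauder_basis e" and "w \<noteq> 0" and \<delta>: "0 < \<delta>"
  obtains N where "(1 - \<delta>) * norm w powr q \<le> norm (basis_proj e N w) powr q"
    "norm (basis_proj e N w - w) \<le> \<delta> * norm w"
proof -
  note lim = basis_proj_tendsto[OF e, of w]
  have "(\<lambda>N. norm (basis_proj e N w) powr q) \<longlonglongrightarrow> norm w powr q"
    using \<open>w \<noteq> 0\<close> lim by (intro tendsto_powr tendsto_norm tendsto_const) auto
  moreover have "(1 - \<delta>) * norm w powr q < norm w powr q"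
    using \<delta> \<open>w \<noteq> 0\<close> by (simp add: mult_less_cancel_right1)
  ultimately have "\<forall>\<^sub>F N in sequentially. (1 - \<delta>) * norm w powr q < norm (basis_proj e N w) powr q"
    by (rule order_tendstoD)
  moreover have "\<forall>\<^sub>F N in sequentially. norm (basis_proj e N w - w) < \<delta> * norm w"
    using tendstoD[OF lim, of "\<delta> * norm w"] \<delta> \<open>w \<noteq> 0\<close> by (simp add: dist_norm)
  ultimately have "\<forall>\<^sub>F N in sequentially. (1 - \<delta>) * norm w powr q < norm (basis_proj e N w) powr q \<and>
      norm (basis_proj e N w - w) < \<delta> * norm w"
    by (rule eventually_conj)
  then obtain N where "(1 - \<delta>) * norm w powr q < norm (basis_proj e N w) powr q"
      "norm (basis_proj e N w - w) < \<delta> * norm w"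
    using eventually_happens'[OF sequentially_bot] by blast
  thus ?thesis by (intro that[of N] less_imp_le)
qed

lemma schauder_basis_nonzero:
  assumes e: "schauder_basis e"
  shows "e k \<noteq> 0"
proof
  assume "e k = 0"
  have zero: "(\<lambda>n. \<Sum>i<n. a i *\<^sub>R e i) \<longlonglongrightarrow> 0" if "\<And>i. i \<noteq> k \<Longrightarrow> a i = 0" for a
  proof -
    have "a i *\<^sub>R e i = 0" for i using that \<open>e k = 0\<close> by (cases "i = k") auto
    hence "(\<Sum>i<n. a i *\<^sub>R e i) = 0" for n by (intro sum.neutral ballI)
    thus ?thesis by simp
  qed
  have "(\<lambda>i. if i = k then 1 else 0) = basis_coeffs e 0"
    by (rule basis_coeffs_unique[OF e zero, symmetric]) simp
  also have "basis_coeffs e 0 = (\<lambda>i. 0)"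
    by (rule basis_coeffs_unique[OF e zero]) simp
  finally show False by (metis zero_neq_one)
qed

lemma basis_coeffs_add_scaleR:
  assumes e: "schauder_basis e"
  shows "basis_coeffs e (x + s *\<^sub>R y) = (\<lambda>i. basis_coeffs e x i + s * basis_coeffs e y i)"
proof (rule basis_coeffs_unique[OF e])
  have "(\<lambda>n. basis_proj e n x + s *\<^sub>R basis_proj e n y) \<longlonglongrightarrow> x + s *\<^sub>R y"
    by (intro tendsto_intros basis_proj_tendsto[OF e])
  thus "(\<lambda>n. \<Sum>i<n. (basis_coeffs e x i + s * basis_coeffs e y i) *\<^sub>R e i) \<longlonglongrightarrow> x + s *\<^sub>R y"
    by (simp add: basis_proj_def scaleR_add_left sum.distrib scaleR_sum_right)
qed

lemma basis_coeffs_basis_proj: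
  assumes e: "schauder_basis e"
  shows "basis_coeffs e (basis_proj e N y) = (\<lambda>i. if i < N then basis_coeffs e y i else 0)"
proof (rule basis_coeffs_unique[OF e])
  let ?a = "\<lambda>i. if i < N then basis_coeffs e y i else 0"
  have "(\<Sum>i<n. ?a i *\<^sub>R e i) = basis_proj e N y" if "n \<ge> N" for n
    unfolding basis_proj_def using that by (intro sum.mono_neutral_cong_right) auto
  thus "(\<lambda>n. \<Sum>i<n. ?a i *\<^sub>R e i) \<longlonglongrightarrow> basis_proj e N y"
    by (intro tendsto_eventually eventually_mono[OF eventually_ge_at_top[of N]])
qed

lemma linear_basis_proj:
  assumes e: "schauder_basis e"
  shows "linear (basis_proj e N)"
proof -
  have add_scaleR: "basis_proj e N (x + s *\<^sub>R y) = basis_proj e N x + s *\<^sub>R basis_proj e N y" for x y s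
    by (simp add: basis_proj_def basis_coeffs_add_scaleR[OF e] scaleR_add_left sum.distrib
        scaleR_sum_right)
  have "basis_proj e N 0 = 0" using add_scaleR[of 0 1 0] by simp
  show ?thesis
  proof (rule linearI)
    show "basis_proj e N (x + y) = basis_proj e N x + basis_proj e N y" for x y
      using add_scaleR[of x 1 y] by simp
    show "basis_proj e N (s *\<^sub>R y) = s *\<^sub>R basis_proj e N y" for s y
      using add_scaleR[of 0 s y] \<open>basis_proj e N 0 = 0\<close> by simp
  qed
qed

lemma basis_proj_idem:
  assumes "schauder_basis e"
  shows "basis_proj e N (basis_proj e N y) = basis_proj e N y"
  unfolding basis_proj_def[of e N "basis_proj e N y"] basis_coeffs_basis_proj[OF assms]
  by (simp add: basis_proj_def)

lemma lower_estimate_basis_proj: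
  assumes e: "schauder_basis e" and lower: "lower_estimate_const1 e q"
  shows "norm (basis_proj e N y) powr q + norm (y - basis_proj e N y) powr q \<le> norm y powr q"
proof -
  define v where "v i = (if i = (0::nat) then basis_proj e N y else y - basis_proj e N y)" for i
  have "basis_coeffs e (y - basis_proj e N y) = (\<lambda>i. if i < N then 0 else basis_coeffs e y i)"
    using basis_coeffs_add_scaleR[OF e, of y "- 1" "basis_proj e N y"]
    by (auto simp: basis_coeffs_basis_proj[OF e])
  hence "\<forall>i<2. \<forall>j<2. i \<noteq> j \<longrightarrow> basis_support e (v i) \<inter> basis_support e (v j) = {}"
    by (auto simp: less_2_cases_iff v_def basis_support_def basis_coeffs_basis_proj[OF e])
  hence "(\<Sum>i<2. norm (v i) powr q) \<le> norm (\<Sum>i<2. v i) powr q"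
    using lower unfolding lower_estimate_const1_def by blast
  thus ?thesis by (simp add: v_def numeral_2_eq_2)
qed

lemma norm_basis_proj_le:
  assumes "schauder_basis e" "lower_estimate_const1 e q" and q: "q > 0"
  shows "norm (basis_proj e N y) \<le> norm y"
proof -
  have "norm (basis_proj e N y) powr q \<le> norm y powr q"
    using lower_estimate_basis_proj[OF assms(1,2), of N y]
      powr_ge_zero[of "norm (y - basis_proj e N y)" q] by linarith
  thus ?thesis using q powr_less_mono2[of q "norm y" "norm (basis_proj e N y)"] by force
qed

lemma compact_linear_combinations:
  fixes e :: "nat \<Rightarrow> 'a::real_normed_vector"
  shows "compact {\<Sum>i<N. a i *\<^sub>R e i | a. \<forall>i<N. \<bar>a i\<bar> \<le> B i}"
proof (induction N)
  case (Suc N)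
  let ?S = "{\<Sum>i<N. a i *\<^sub>R e i | a. \<forall>i<N. \<bar>a i\<bar> \<le> B i}" and ?T = "(\<lambda>t. t *\<^sub>R e N) ` {- B N..B N}"
  have "compact {x + y | x y. x \<in> ?S \<and> y \<in> ?T}"
    by (intro compact_sums Suc.IH compact_continuous_image continuous_intros compact_Icc)
  moreover have "{x + y | x y. x \<in> ?S \<and> y \<in> ?T} = {\<Sum>i<Suc N. a i *\<^sub>R e i | a. \<forall>i<Suc N. \<bar>a i\<bar> \<le> B i}"
  proof (intro equalityI subsetI)
    fix z assume "z \<in> {x + y | x y. x \<in> ?S \<and> y \<in> ?T}"
    then obtain a t where z: "z = (\<Sum>i<N. a i *\<^sub>R e i) + t *\<^sub>R e N"
      and at: "\<forall>i<N. \<bar>a i\<bar> \<le> B i" "\<bar>t\<bar> \<le> B N" by (auto simp: abs_le_iff minus_le_iff)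
    have "z = (\<Sum>i<Suc N. (a(N := t)) i *\<^sub>R e i)" using z by simp
    moreover have "\<forall>i<Suc N. \<bar>(a(N := t)) i\<bar> \<le> B i" using at by (auto simp: less_Suc_eq)
    ultimately show "z \<in> {\<Sum>i<Suc N. a i *\<^sub>R e i | a. \<forall>i<Suc N. \<bar>a i\<bar> \<le> B i}" by blast
  next
    fix z assume "z \<in> {\<Sum>i<Suc N. a i *\<^sub>R e i | a. \<forall>i<Suc N. \<bar>a i\<bar> \<le> B i}"
    then obtain a where z: "z = (\<Sum>i<N. a i *\<^sub>R e i) + a N *\<^sub>R e N" and a: "\<forall>i<Suc N. \<bar>a i\<bar> \<le> B i"
      by auto
    have "(\<Sum>i<N. a i *\<^sub>R e i) \<in> ?S" using a by auto
    moreover have "a N *\<^sub>R e N \<in> ?T" using a by (intro imageI) (auto simp: abs_le_iff minus_le_iff)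
    ultimately show "z \<in> {x + y | x y. x \<in> ?S \<and> y \<in> ?T}" using z by blast
  qed
  ultimately show ?case by (rule back_subst)
qed simp

lemma basis_proj_cball_subset_compact:
  assumes e: "schauder_basis e" and lower: "lower_estimate_const1 e q" and q: "q > 0"
  obtains K where "compact K" "basis_proj e N ` cball 0 r \<subseteq> K"
proof -
  let ?K = "{\<Sum>i<N. a i *\<^sub>R e i | a. \<forall>i<N. \<bar>a i\<bar> \<le> 2 * r / norm (e i)}"
  have "\<bar>basis_coeffs e z i\<bar> \<le> 2 * r / norm (e i)" if "norm z \<le> r" for z i
  proof -
    have "norm (basis_coeffs e z i *\<^sub>R e i) = norm (basis_proj e (Suc i) z - basis_proj e i z)"
      by (simp add: basis_proj_def)
    also have "\<dots> \<le> r + r"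
      using norm_triangle_ineq4[of "basis_proj e (Suc i) z" "basis_proj e i z"] that
        norm_basis_proj_le[OF assms, of "Suc i" z] norm_basis_proj_le[OF assms, of i z] by linarith
    finally show ?thesis using schauder_basis_nonzero[OF e, of i] by (simp add: field_simps)
  qed
  hence "basis_proj e N z \<in> ?K" if "norm z \<le> r" for z
    unfolding basis_proj_def using that by blast
  hence "basis_proj e N ` cball 0 r \<subseteq> ?K" by (intro image_subsetI) simp
  thus ?thesis by (rule that[OF compact_linear_combinations])
qed

lemma norm_diff_projection_le_if_midpoint:
  fixes P :: "'a::real_normed_vector \<Rightarrow> 'a"
  assumes P: "linear P" "P (P w) = P w"
    and split: "\<And>v. norm (P v) powr q + norm (v - P v) powr q \<le> norm v powr q"
    and q: "1 \<le> q" and d: "0 < d" "d \<le> 1"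
    and w: "(1 - d) * norm w powr q \<le> norm (P w) powr q" "norm (P w - w) \<le> d * norm w"
    and z: "norm (w - z) \<le> (1 + d) * norm w" "norm (w + z) \<le> (1 + d) * norm w"
  shows "norm (z - P z) \<le> ((3 powr q + 1) * d) powr (1 / q) * norm w"
proof -
  have shifted: "norm (P w + s *\<^sub>R P z) powr q + norm (z - P z) powr q \<le> ((1 + 2 * d) * norm w) powr q"
    if s: "\<bar>s\<bar> = 1" "norm (w + s *\<^sub>R z) \<le> (1 + d) * norm w" for s
  proof -
    let ?v = "P w + s *\<^sub>R z"
    have Pv: "P ?v = P w + s *\<^sub>R P z" by (simp add: linear_add[OF P(1)] linear_scale[OF P(1)] P(2))
    have "?v - P ?v = s *\<^sub>R (z - P z)" unfolding Pv by (simp add: scaleR_right_diff_distrib)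
    hence "norm (?v - P ?v) = norm (z - P z)" using s(1) by simp
    moreover have "norm ?v \<le> (1 + 2 * d) * norm w"
      using norm_triangle_ineq[of "w + s *\<^sub>R z" "P w - w"] s(2) w(2) by (simp add: algebra_simps)
    hence "norm ?v powr q \<le> ((1 + 2 * d) * norm w) powr q" using q by (intro powr_mono2) auto
    ultimately show ?thesis using split[of ?v] Pv by simp
  qed
  have "2 * norm (P w) \<le> norm (P w + P z) + norm (P w - P z)"
    using norm_triangle_ineq[of "P w + P z" "P w - P z"] by (simp add: scaleR_2[symmetric])
  then consider "norm (P w) \<le> norm (P w + P z)" | "norm (P w) \<le> norm (P w - P z)" by linarith
  hence "norm (P w) powr q + norm (z - P z) powr q \<le> ((1 + 2 * d) * norm w) powr q"
  proof cases
    case 1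
    hence "norm (P w) powr q \<le> norm (P w + P z) powr q" using q by (intro powr_mono2) auto
    thus ?thesis using shifted[of 1] z(2) by simp
  next
    case 2
    hence "norm (P w) powr q \<le> norm (P w - P z) powr q" using q by (intro powr_mono2) auto
    thus ?thesis using shifted[of "- 1"] z(1) by simp
  qed
  also have "\<dots> = (1 + 2 * d) powr q * norm w powr q" by (rule powr_mult)
  also have "\<dots> \<le> (1 + 3 powr q * d) * norm w powr q"
    using one_plus_powr_le[OF q, of 2 d] d by (intro mult_right_mono) auto
  finally have "norm (z - P z) powr q \<le> ((3 powr q + 1) * d) * norm w powr q"
    using w(1) by (simp add: algebra_simps)
  hence "norm (z - P z) \<le> (((3 powr q + 1) * d) * norm w powr q) powr (1 / q)"
    using q by (intro le_powr_inverse) auto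
  also have "\<dots> = ((3 powr q + 1) * d) powr (1 / q) * (norm w powr q) powr (1 / q)"
    by (rule powr_mult)
  also have "(norm w powr q) powr (1 / q) = norm w" using q by (simp add: powr_powr)
  finally show ?thesis .
qed

lemma lower_estimate_approx_midpoints_net:
  fixes e :: "nat \<Rightarrow> 'a::real_normed_vector" and x y :: 'a
  assumes e: "schauder_basis e" and lower: "lower_estimate_const1 e q" and q: "1 \<le> q"
    and \<delta>: "0 < \<delta>" "\<delta> \<le> 1"
  shows "has_finite_net (approx_midpoints x y \<delta>) (((3 powr q + 1) * \<delta>) powr (1 / q) * dist x y)"
proof (cases "x = y")
  case True
  thus ?thesis
    unfolding has_finite_net_def by (intro exI[of _ "{x}"]) (auto simp: approx_midpoints_def)
next
  case False
  define w where "w = (1 / 2) *\<^sub>R (x - y)"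
  define \<rho> where "\<rho> = ((3 powr q + 1) * \<delta>) powr (1 / q) * norm w"
  have "norm w > 0" using False by (simp add: w_def)
  have "(3 powr q + 1) * \<delta> > 0" using \<delta>(1) by (intro mult_pos_pos add_nonneg_pos) auto
  hence "\<rho> > 0" using \<open>norm w > 0\<close> unfolding \<rho>_def by (intro mult_pos_pos) auto
  have radius: "2 * \<rho> = ((3 powr q + 1) * \<delta>) powr (1 / q) * dist x y"
    by (simp add: \<rho>_def w_def dist_norm)
  obtain N where N: "(1 - \<delta>) * norm w powr q \<le> norm (basis_proj e N w) powr q"
      "norm (basis_proj e N w - w) \<le> \<delta> * norm w"
    using basis_proj_approx[OF e _ \<delta>(1), of w q] \<open>norm w > 0\<close> by auto
  obtain K where K: "compact K" "basis_proj e N ` cball 0 (2 * norm w) \<subseteq> K"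
    using basis_proj_cball_subset_compact[OF e lower less_le_trans[OF zero_less_one q]] by blast
  obtain A where A: "finite A" "K \<subseteq> (\<Union>a\<in>A. ball a \<rho>)"
    using K(1) \<open>\<rho> > 0\<close> unfolding compact_eq_totally_bounded by blast
  have "\<exists>a\<in>A. z \<in> cball (midpoint x y + a) (2 * \<rho>)" if "z \<in> approx_midpoints x y \<delta>" for z
  proof -
    define v where "v = z - midpoint x y"
    have v: "norm (w - v) \<le> (1 + \<delta>) * norm w" "norm (w + v) \<le> (1 + \<delta>) * norm w"
      using that midpoint_add_in_approx_midpoints_iff[of x y v \<delta>] by (auto simp: v_def w_def)
    have "2 * norm v \<le> norm (w + v) + norm (w - v)"
      using norm_triangle_ineq4[of "w + v" "w - v"] by (simp flip: scaleR_2)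
    moreover have "(1 + \<delta>) * norm w \<le> 2 * norm w" using \<delta> by (intro mult_right_mono) auto
    ultimately have "v \<in> cball 0 (2 * norm w)" using v by simp
    then obtain a where a: "a \<in> A" "dist a (basis_proj e N v) < \<rho>" using K(2) A(2) by fastforce
    have "norm (v - basis_proj e N v) \<le> \<rho>"
      unfolding \<rho>_def
      by (rule norm_diff_projection_le_if_midpoint[OF linear_basis_proj[OF e] basis_proj_idem[OF e]
            lower_estimate_basis_proj[OF e lower] q \<delta> N v])
    hence "dist a v \<le> 2 * \<rho>"
      using a(2) dist_triangle[of a v "basis_proj e N v"]
      by (simp add: dist_norm norm_minus_commute)
    moreover have "dist (midpoint x y + a) z = dist a v"
      by (simp add: v_def dist_norm algebra_simps)
    ultimately show ?thesis using a(1) by (intro bexI[of _ a]) simp_all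
  qed
  hence "approx_midpoints x y \<delta> \<subseteq> (\<Union>a\<in>(+) (midpoint x y) ` A. cball a (2 * \<rho>))" by blast
  moreover have "finite ((+) (midpoint x y) ` A)" using A(1) by (rule finite_imageI)
  ultimately show ?thesis unfolding has_finite_net_def radius by (intro exI conjI)
qed

subsection \<open>Coarse Lipschitz maps\<close>

definition coarse_lipschitz :: "real \<Rightarrow> ('a::metric_space \<Rightarrow> 'b::metric_space) \<Rightarrow> bool" where
  "coarse_lipschitz L f \<longleftrightarrow> 0 < L \<and> (\<forall>x y. dist (f x) (f y) \<le> L * dist x y + L)"

lemma coarse_lipschitzD: "coarse_lipschitz L f \<Longrightarrow> dist (f x) (f y) \<le> L * dist x y + L"
  by (simp add: coarse_lipschitz_def)

definition lipschitz_beyond :: "real \<Rightarrow> real \<Rightarrow> ('a::metric_space \<Rightarrow> 'b::metric_space) \<Rightarrow> bool" where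
  "lipschitz_beyond s c f \<longleftrightarrow> (\<forall>x y. s \<le> dist x y \<longrightarrow> dist (f x) (f y) \<le> c * dist x y)"

definition lipschitz_const_at_infinity :: "('a::metric_space \<Rightarrow> 'b::metric_space) \<Rightarrow> real" where
  "lipschitz_const_at_infinity f = Inf {c. 0 \<le> c \<and> (\<exists>s. lipschitz_beyond s c f)}"

lemma lipschitz_beyondD: "lipschitz_beyond s c f \<Longrightarrow> s \<le> dist x y \<Longrightarrow> dist (f x) (f y) \<le> c * dist x y"
  by (simp add: lipschitz_beyond_def)

lemma lipschitz_beyond_mono:
  fixes f :: "'a::metric_space \<Rightarrow> 'b::metric_space"
  assumes "lipschitz_beyond s c f" "s \<le> s'" "c \<le> c'"
  shows "lipschitz_beyond s' c' f"
  unfolding lipschitz_beyond_def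
proof (intro allI impI)
  fix x y :: 'a assume "s' \<le> dist x y"
  hence "dist (f x) (f y) \<le> c * dist x y"
    by (rule lipschitz_beyondD[OF assms(1) order_trans[OF assms(2)]])
  also have "\<dots> \<le> c' * dist x y" using assms(3) by (rule mult_right_mono) simp
  finally show "dist (f x) (f y) \<le> c' * dist x y" .
qed

lemma coarse_lipschitz_imp_lipschitz_beyond:
  fixes f :: "'a::metric_space \<Rightarrow> 'b::metric_space"
  assumes f: "coarse_lipschitz L f"
  shows "lipschitz_beyond 1 (2 * L) f"
  unfolding lipschitz_beyond_def
proof (intro allI impI)
  fix x y :: 'a assume "1 \<le> dist x y"
  hence "L \<le> L * dist x y" using f by (simp add: coarse_lipschitz_def)
  thus "dist (f x) (f y) \<le> 2 * L * dist x y" using coarse_lipschitzD[OF f, of x y] by simp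
qed

lemma lipschitz_const_at_infinity_less:
  assumes f: "coarse_lipschitz L f" and "lipschitz_const_at_infinity f < c"
  obtains s where "s \<ge> 1" "lipschitz_beyond s c f"
proof -
  let ?S = "{c. 0 \<le> c \<and> (\<exists>s. lipschitz_beyond s c f)}"
  have "0 \<le> 2 * L" using f by (simp add: coarse_lipschitz_def)
  hence "?S \<noteq> {}" using coarse_lipschitz_imp_lipschitz_beyond[OF f] by blast
  then obtain c' s where "c' < c" and s: "lipschitz_beyond s c' f"
    using cInf_lessD[of ?S c] assms(2) unfolding lipschitz_const_at_infinity_def by blast
  hence "lipschitz_beyond (max s 1) c f" by (intro lipschitz_beyond_mono[OF s]) auto
  thus ?thesis using that[of "max s 1"] by simp
qed

lemma less_lipschitz_const_at_infinity:
  fixes f :: "'a::metric_space \<Rightarrow> 'b::metric_space"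
  assumes "0 \<le> c" "c < lipschitz_const_at_infinity f"
  obtains x y where "s \<le> dist x y" "c * dist x y < dist (f x) (f y)"
proof -
  have "\<not> lipschitz_beyond s c f"
  proof
    assume "lipschitz_beyond s c f"
    hence "lipschitz_const_at_infinity f \<le> c"
      unfolding lipschitz_const_at_infinity_def using \<open>0 \<le> c\<close> by (intro cInf_lower bdd_belowI) auto
    thus False using assms(2) by simp
  qed
  thus ?thesis using that by (auto simp: lipschitz_beyond_def not_le)
qed

text \<open>Far-apart pairs that nearly attain the Lipschitz constant at infinity leave no slack in the
  triangle inequality, so their approximate midpoints have to go to approximate midpoints.\<close>

lemma coarse_lipschitz_image_approx_midpoints:
  fixes f :: "'a::metric_space \<Rightarrow> 'b::metric_space"
  assumes f: "coarse_lipschitz L f" and pos: "0 < lipschitz_const_at_infinity f"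
    and \<kappa>: "0 < \<kappa>" "\<kappa> \<le> 1 / 2"
  obtains x y where "s \<le> dist x y"
    "f ` approx_midpoints x y \<kappa> \<subseteq> approx_midpoints (f x) (f y) (2 * \<kappa>)"
proof -
  let ?\<Lambda> = "lipschitz_const_at_infinity f"
  define c1 c2 where "c1 = ?\<Lambda> * (1 + \<kappa> / 8)" and "c2 = ?\<Lambda> * (1 - \<kappa> / 8)"
  have c: "?\<Lambda> < c1" "c2 < ?\<Lambda>" "0 \<le> c2" "0 \<le> c1" using pos \<kappa> by (auto simp: c1_def c2_def)
  have ratio: "c1 * (1 + \<kappa>) \<le> (1 + 2 * \<kappa>) * c2"
  proof -
    have "\<kappa> * \<kappa> \<le> \<kappa> * (1 / 2)" using \<kappa> by (intro mult_left_mono) auto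
    moreover have "(1 + 2 * \<kappa>) * (1 - \<kappa> / 8) - (1 + \<kappa> / 8) * (1 + \<kappa>) = 3 / 4 * \<kappa> - 3 / 8 * (\<kappa> * \<kappa>)"
      by (simp add: field_simps)
    ultimately have "(1 + \<kappa> / 8) * (1 + \<kappa>) \<le> (1 + 2 * \<kappa>) * (1 - \<kappa> / 8)" using \<kappa> by linarith
    hence "?\<Lambda> * ((1 + \<kappa> / 8) * (1 + \<kappa>)) \<le> ?\<Lambda> * ((1 + 2 * \<kappa>) * (1 - \<kappa> / 8))"
      using pos by (intro mult_left_mono) auto
    thus ?thesis by (simp add: c1_def c2_def ac_simps)
  qed
  obtain s1 where s1: "s1 \<ge> 1" "lipschitz_beyond s1 c1 f"
    using lipschitz_const_at_infinity_less[OF f c(1)] by blast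
  obtain x y where far: "max s (4 * s1) \<le> dist x y"
    and stretched: "c2 * dist x y < dist (f x) (f y)"
    using less_lipschitz_const_at_infinity[OF c(3,2)] by blast
  have half: "dist (f a) (f z) \<le> (1 + 2 * \<kappa>) / 2 * dist (f x) (f y)"
    if ab: "dist a b = dist x y"
      and z: "dist a z \<le> (1 + \<kappa>) / 2 * dist x y" "dist b z \<le> (1 + \<kappa>) / 2 * dist x y"
    for a b z
  proof -
    have "(1 + \<kappa>) / 2 * dist x y \<le> 3 / 4 * dist x y" using \<kappa> by (intro mult_right_mono) auto
    hence "s1 \<le> dist a z" using dist_triangle2[of a b z] ab z far by linarith
    hence "dist (f a) (f z) \<le> c1 * dist a z" by (rule lipschitz_beyondD[OF s1(2)])
    also have "\<dots> \<le> c1 * ((1 + \<kappa>) / 2 * dist x y)" using z(1) c(4) by (rule mult_left_mono)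
    also have "\<dots> = c1 * (1 + \<kappa>) * (dist x y / 2)" by simp
    also have "\<dots> \<le> (1 + 2 * \<kappa>) * c2 * (dist x y / 2)" using ratio by (rule mult_right_mono) simp
    also have "\<dots> = (1 + 2 * \<kappa>) / 2 * (c2 * dist x y)" by simp
    also have "\<dots> \<le> (1 + 2 * \<kappa>) / 2 * dist (f x) (f y)"
      using stretched \<kappa> by (intro mult_left_mono) auto
    finally show ?thesis .
  qed
  have "f z \<in> approx_midpoints (f x) (f y) (2 * \<kappa>)" if "z \<in> approx_midpoints x y \<kappa>" for z
    using that half[of x y z] half[of y x z] by (simp add: approx_midpoints_def dist_commute)
  thus ?thesis using far by (intro that[of x y]) auto
qed

lemma coarse_lipschitz_image_cball:
  fixes f :: "'a::metric_space \<Rightarrow> 'b::metric_space"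
  assumes f: "coarse_lipschitz L f" and small: "lipschitz_const_at_infinity f < \<delta>" and "\<delta> > 0"
  obtains \<tau> where "t < \<tau>" "f ` cball x \<tau> \<subseteq> cball (f x) (\<delta> * \<tau>)"
proof -
  obtain s where s: "s \<ge> 1" "lipschitz_beyond s \<delta> f"
    using lipschitz_const_at_infinity_less[OF f small] by blast
  have "0 < L" using f by (simp add: coarse_lipschitz_def)
  define \<tau> where "\<tau> = max (t + 1) ((L * s + L) / \<delta>)"
  have "(L * s + L) / \<delta> \<le> \<tau>" by (simp add: \<tau>_def)
  hence \<tau>: "L * s + L \<le> \<delta> * \<tau>" using \<open>\<delta> > 0\<close> by (simp add: pos_divide_le_eq mult.commute)
  have "dist (f x) (f y) \<le> \<delta> * \<tau>" if y: "dist x y \<le> \<tau>" for y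
  proof (cases "s \<le> dist x y")
    case True
    hence "dist (f x) (f y) \<le> \<delta> * dist x y" by (rule lipschitz_beyondD[OF s(2)])
    also have "\<dots> \<le> \<delta> * \<tau>" using y \<open>\<delta> > 0\<close> by simp
    finally show ?thesis .
  next
    case False
    hence "L * dist x y \<le> L * s" using \<open>0 < L\<close> by simp
    thus ?thesis using coarse_lipschitzD[OF f, of x y] \<tau> by linarith
  qed
  moreover have "t < \<tau>" by (simp add: \<tau>_def)
  ultimately show ?thesis by (intro that[of \<tau>]) auto
qed

lemma eventually_mult_powr_le:
  fixes \<beta> M \<delta> :: real
  assumes "\<beta> > 0" "\<delta> > 0"
  shows "\<forall>\<^sub>F \<theta> in at_right 0. M * \<theta> powr \<beta> \<le> \<delta>"
proof -
  have "((\<lambda>\<theta>. \<theta> powr \<beta>) \<longlongrightarrow> 0) (at_right (0::real))"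
    using \<open>\<beta> > 0\<close> by (intro tendsto_zero_powrI[where b = \<beta>])
      (auto intro: tendsto_ident_at eventually_mono[OF eventually_at_right_less])
  hence "((\<lambda>\<theta>. M * \<theta> powr \<beta>) \<longlongrightarrow> 0) (at_right 0)" by (rule tendsto_mult_right_zero)
  hence "\<forall>\<^sub>F \<theta> in at_right 0. M * \<theta> powr \<beta> < \<delta>" using \<open>\<delta> > 0\<close> by (rule order_tendstoD)
  thus ?thesis by eventually_elim simp
qed

lemma midpoint_net_radius_eq:
  fixes B C D L p q \<theta> :: real
  assumes "0 < \<theta>"
  shows "(B * (2 * (C * \<theta> powr p))) powr (1 / q) * (2 * L * D) =
    (B * (2 * C)) powr (1 / q) * 4 * L * \<theta> powr (p / q - 1) * (\<theta> * D / 2)"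
proof -
  have "(B * (2 * C) * \<theta> powr p) powr (1 / q) = (B * (2 * C)) powr (1 / q) * (\<theta> powr p) powr (1 / q)"
    by (rule powr_mult)
  moreover have "(\<theta> powr p) powr (1 / q) = \<theta> powr (p / q - 1) * \<theta>"
    using assms by (simp add: powr_powr powr_diff)
  ultimately show ?thesis by (simp add: mult.assoc)
qed

text \<open>With \<open>\<kappa>\<close> of order \<open>\<theta> powr p\<close>, the \<open>\<kappa>\<close>-approximate midpoints of a pair at distance \<open>D\<close> contain
  a ball of radius of order \<open>\<theta> D\<close> of a finite-codimensional subspace, whereas their images lie within
  order \<open>\<theta> powr (p / q) D\<close> of a finite set; take \<open>\<theta>\<close> small.\<close>

lemma coarse_lipschitz_midpoints_flat:
  fixes f :: "'a::real_normed_vector \<Rightarrow> 'b::real_normed_vector" and e :: "nat \<Rightarrow> 'b"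
  assumes f: "coarse_lipschitz L f" and pos: "0 < lipschitz_const_at_infinity f"
    and smooth: "asymptotically_uniformly_smooth_power TYPE('a::real_normed_vector) p"
    and basis: "schauder_basis e" "lower_estimate_const1 e q"
    and q: "1 \<le> q" "q < p" and \<delta>: "\<delta> > 0" and t: "0 \<le> t"
  obtains u \<tau> E where "t < \<tau>" "fin_codim_subspace E"
    "has_finite_net (f ` (+) u ` (E \<inter> cball 0 \<tau>)) (\<delta> * \<tau>)"
proof -
  obtain C where C: "C \<ge> 1"
    "\<And>(x::'a) y \<theta>. 0 < \<theta> \<Longrightarrow> \<theta> \<le> 1 \<Longrightarrow> \<exists>E. fin_codim_subspace E \<and>
       (+) (midpoint x y) ` (E \<inter> cball 0 (\<theta> * dist x y / 2)) \<subseteq> approx_midpoints x y (C * \<theta> powr p)"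
    using asym_smooth_approx_midpoints[OF smooth] by blast
  define K where "K = ((3 powr q + 1) * (2 * C)) powr (1 / q)"
  have "\<forall>\<^sub>F \<theta> in at_right 0. \<theta> \<in> {0<..<1} \<and> C * \<theta> powr p \<le> 1 / 2 \<and> K * 4 * L * \<theta> powr (p / q - 1) \<le> \<delta>"
    using q \<delta> by (intro eventually_conj eventually_at_right_real eventually_mult_powr_le) auto
  then obtain \<theta> where \<theta>: "\<theta> \<in> {0<..<1}" "C * \<theta> powr p \<le> 1 / 2" "K * 4 * L * \<theta> powr (p / q - 1) \<le> \<delta>"
    using eventually_happens'[OF trivial_limit_at_right_real] by blast
  define \<kappa> where "\<kappa> = C * \<theta> powr p"
  have \<kappa>: "0 < \<kappa>" "\<kappa> \<le> 1 / 2" using \<theta> C(1) by (auto simp: \<kappa>_def)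
  obtain x y where far: "max 1 (2 * (t + 1) / \<theta>) \<le> dist x y"
    and image: "f ` approx_midpoints x y \<kappa> \<subseteq> approx_midpoints (f x) (f y) (2 * \<kappa>)"
    using coarse_lipschitz_image_approx_midpoints[OF f pos \<kappa>] by blast
  define \<tau> where "\<tau> = \<theta> * dist x y / 2"
  have "t + 1 \<le> \<tau>" using far \<theta>(1) by (simp add: \<tau>_def field_simps)
  obtain E where E: "fin_codim_subspace E"
    "(+) (midpoint x y) ` (E \<inter> cball 0 \<tau>) \<subseteq> approx_midpoints x y \<kappa>"
    using C(2)[of \<theta> x y] \<theta>(1) by (auto simp: \<tau>_def \<kappa>_def)
  define R where "R = ((3 powr q + 1) * (2 * \<kappa>)) powr (1 / q) * dist (f x) (f y)"
  have net: "has_finite_net (approx_midpoints (f x) (f y) (2 * \<kappa>)) R"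
    unfolding R_def using \<kappa> by (intro lower_estimate_approx_midpoints_net[OF basis q(1)]) auto
  have "R \<le> \<delta> * \<tau>"
  proof -
    have "R \<le> ((3 powr q + 1) * (2 * \<kappa>)) powr (1 / q) * (2 * L * dist x y)"
      using far lipschitz_beyondD[OF coarse_lipschitz_imp_lipschitz_beyond[OF f], of x y]
      unfolding R_def by (intro mult_left_mono) auto
    also have "\<dots> = K * 4 * L * \<theta> powr (p / q - 1) * \<tau>"
      unfolding K_def \<kappa>_def \<tau>_def using \<theta>(1) by (intro midpoint_net_radius_eq) simp
    also have "\<dots> \<le> \<delta> * \<tau>" using \<theta>(3) \<open>t + 1 \<le> \<tau>\<close> t by (intro mult_right_mono) auto
    finally show ?thesis .
  qed
  have "f ` (+) (midpoint x y) ` (E \<inter> cball 0 \<tau>) \<subseteq> f ` approx_midpoints x y \<kappa>"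
    using E(2) by (rule image_mono)
  also note image
  finally have "has_finite_net (f ` (+) (midpoint x y) ` (E \<inter> cball 0 \<tau>)) (\<delta> * \<tau>)"
    using \<open>R \<le> \<delta> * \<tau>\<close> by (rule has_finite_net_mono[OF net])
  thus ?thesis using \<open>t + 1 \<le> \<tau>\<close> E(1) by (intro that) auto
qed

lemma coarse_lipschitz_flat_on_fin_codim:
  fixes f :: "'a::real_normed_vector \<Rightarrow> 'b::real_normed_vector" and e :: "nat \<Rightarrow> 'b"
  assumes f: "coarse_lipschitz L f"
    and smooth: "asymptotically_uniformly_smooth_power TYPE('a::real_normed_vector) p"
    and basis: "schauder_basis e" "lower_estimate_const1 e q"
    and q: "1 \<le> q" "q < p" and \<delta>: "\<delta> > 0" and t: "0 \<le> t"
  obtains u \<tau> E where "t < \<tau>" "fin_codim_subspace E"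
    "has_finite_net (f ` (+) u ` (E \<inter> cball 0 \<tau>)) (\<delta> * \<tau>)"
proof (cases "lipschitz_const_at_infinity f < \<delta>")
  case True
  then obtain \<tau> where \<tau>: "t < \<tau>" "f ` cball 0 \<tau> \<subseteq> cball (f 0) (\<delta> * \<tau>)"
    using coarse_lipschitz_image_cball[OF f _ \<delta>] by blast
  have "f ` (+) 0 ` (UNIV \<inter> cball 0 \<tau>) \<subseteq> (\<Union>a\<in>{f 0}. cball a (\<delta> * \<tau>))" using \<tau>(2) by simp
  hence "has_finite_net (f ` (+) 0 ` (UNIV \<inter> cball 0 \<tau>)) (\<delta> * \<tau>)"
    unfolding has_finite_net_def by blast
  with \<tau>(1) fin_codim_subspace_UNIV show ?thesis by (rule that)
next
  case False
  hence "0 < lipschitz_const_at_infinity f" using \<delta> by simp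
  show ?thesis
    by (rule coarse_lipschitz_midpoints_flat[OF f \<open>0 < lipschitz_const_at_infinity f\<close> smooth basis q \<delta> t])
      (rule that)
qed

subsection \<open>Non-embeddability\<close>

lemma coarse_lipschitz_embeddingE:
  fixes f :: "'a::real_normed_vector \<Rightarrow> 'b::real_normed_vector"
  assumes "coarse_lipschitz_embedding f"
  obtains L where "coarse_lipschitz L f" "\<And>x y. dist x y / L - L \<le> dist (f x) (f y)"
proof -
  obtain L where L: "L > 0" "\<And>t. t \<ge> 0 \<Longrightarrow> omega_f f t \<le> ereal (L * t + L)"
    "\<And>t. t \<ge> 0 \<Longrightarrow> ereal (t / L - L) \<le> rho_f f t"
    using assms by (auto simp: coarse_lipschitz_embedding_def)
  have "dist (f x) (f y) \<le> L * dist x y + L" for x y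
  proof -
    have "ereal (norm (f (fst (x, y)) - f (snd (x, y)))) \<le> omega_f f (norm (x - y))"
      unfolding omega_f_def by (rule SUP_upper) simp
    also have "\<dots> \<le> ereal (L * norm (x - y) + L)" by (rule L(2)) simp
    finally show ?thesis by (simp add: dist_norm)
  qed
  moreover have "dist x y / L - L \<le> dist (f x) (f y)" for x y
  proof -
    have "ereal (norm (x - y) / L - L) \<le> rho_f f (norm (x - y))" by (rule L(3)) simp
    also have "\<dots> \<le> ereal (norm (f (fst (x, y)) - f (snd (x, y))))"
      unfolding rho_f_def by (rule INF_lower) simp
    finally show ?thesis by (simp add: dist_norm)
  qed
  ultimately show ?thesis using L(1) by (intro that[of L]) (simp_all add: coarse_lipschitz_def)
qed

lemma coarse_lipschitz_fst: "coarse_lipschitz L f \<Longrightarrow> coarse_lipschitz L (\<lambda>x. fst (f x))"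
  unfolding coarse_lipschitz_def by (meson dist_fst_le order_trans)

lemma coarse_lipschitz_snd: "coarse_lipschitz L f \<Longrightarrow> coarse_lipschitz L (\<lambda>x. snd (f x))"
  unfolding coarse_lipschitz_def by (meson dist_snd_le order_trans)

lemma dist_le_dist_fst_plus_dist_snd: "dist a b \<le> dist (fst a) (fst b) + dist (snd a) (snd b)"
  unfolding dist_prod_def by (intro sqrt_sum_squares_le_sum zero_le_dist)

lemma coarse_lipschitz_sum_concentration:
  fixes f :: "'a::real_normed_vector \<Rightarrow> 'b::real_normed_vector" and y :: "nat \<Rightarrow> 'a"
  assumes refl: "reflexive TYPE('b)" and U: "ultrafilter U"
    and upper: "weak_upper_estimate TYPE('b) q D" and q: "0 < q"
    and f: "coarse_lipschitz L f" and y: "\<And>n. norm (y n) \<le> 1" and r: "1 \<le> r"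
  obtains z where
    "\<forall>\<^sub>F l in iter_filter U k. dist (f (u + r *\<^sub>R (\<Sum>n\<leftarrow>l. y n))) z \<le> 3 * L * r * (real k * D) powr (1 / q)"
proof -
  define \<psi> where "\<psi> l = u + r *\<^sub>R (\<Sum>n\<leftarrow>l. y n)" for l
  define M where "M = 3 * L * r"
  have "L > 0" using f by (simp add: coarse_lipschitz_def)
  hence M: "M > 0" using r by (simp add: M_def)
  have scaled_dist: "norm (a /\<^sub>R M - b /\<^sub>R M) = dist a b / M" for a b :: 'b
    using M by (simp add: dist_norm divide_inverse mult.commute flip: scaleR_right_diff_distrib)
  have "norm (f (\<psi> (xs @ n # ys)) /\<^sub>R M - f (\<psi> (xs @ m # ys)) /\<^sub>R M) \<le> 1" for xs ys n m
  proof -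
    have "dist (\<psi> (xs @ n # ys)) (\<psi> (xs @ m # ys)) = norm (r *\<^sub>R (y n - y m))"
      by (simp add: \<psi>_def dist_norm algebra_simps)
    also have "\<dots> \<le> r * 2"
      using y[of n] y[of m] norm_triangle_ineq4[of "y n" "y m"] r by simp
    finally have "L * dist (\<psi> (xs @ n # ys)) (\<psi> (xs @ m # ys)) \<le> L * (r * 2)"
      using \<open>L > 0\<close> by simp
    moreover have "L \<le> L * r" using \<open>L > 0\<close> r by simp
    ultimately have "dist (f (\<psi> (xs @ n # ys))) (f (\<psi> (xs @ m # ys))) \<le> M"
      using coarse_lipschitzD[OF f, of "\<psi> (xs @ n # ys)" "\<psi> (xs @ m # ys)"] by (simp add: M_def)
    thus ?thesis using M by (simp add: scaled_dist)
  qed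
  then obtain z where
    "\<And>s. \<forall>\<^sub>F l in iter_filter U k. norm (s + (f (\<psi> l) /\<^sub>R M - z)) powr q \<le> norm s powr q + real k * D"
    using reflexive_concentration[OF refl U upper, of k "\<lambda>l. f (\<psi> l) /\<^sub>R M"] by blast
  from this[of 0]
  have "\<forall>\<^sub>F l in iter_filter U k. dist (f (\<psi> l)) (M *\<^sub>R z) \<le> M * (real k * D) powr (1 / q)"
  proof eventually_elim
    case (elim l)
    have "dist (f (\<psi> l)) (M *\<^sub>R z) / M = norm (f (\<psi> l) /\<^sub>R M - z)"
      using scaled_dist[of "f (\<psi> l)" "M *\<^sub>R z"] M by simp
    also have "\<dots> \<le> (real k * D) powr (1 / q)" using elim q by (intro le_powr_inverse) auto
    finally show ?case using M by (simp add: field_simps)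
  qed
  thus ?thesis using that unfolding \<psi>_def M_def by blast
qed

lemma has_finite_net_sum_concentration:
  fixes f :: "'a::real_normed_vector \<Rightarrow> 'b::metric_space" and y :: "nat \<Rightarrow> 'a"
  assumes U: "ultrafilter U" and E: "fin_codim_subspace E" "\<And>n. y n \<in> E"
    and net: "has_finite_net (f ` (+) u ` (E \<inter> cball 0 \<tau>)) \<rho>"
    and bounded: "\<forall>\<^sub>F l in iter_filter U k. norm (r *\<^sub>R (\<Sum>n\<leftarrow>l. y n)) \<le> \<tau>"
  obtains a where "\<forall>\<^sub>F l in iter_filter U k. dist (f (u + r *\<^sub>R (\<Sum>n\<leftarrow>l. y n))) a \<le> \<rho>"
proof -
  obtain A where A: "finite A" "f ` (+) u ` (E \<inter> cball 0 \<tau>) \<subseteq> (\<Union>a\<in>A. cball a \<rho>)"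
    using net unfolding has_finite_net_def by blast
  have sub: "subspace E" using E(1) by (simp add: fin_codim_subspace_def)
  have "(\<Sum>n\<leftarrow>l. y n) \<in> E" for l
    using sub E(2) by (induction l) (simp_all add: subspace_0 subspace_add)
  hence mem: "r *\<^sub>R (\<Sum>n\<leftarrow>l. y n) \<in> E" for l using sub by (intro subspace_scale)
  have "\<forall>\<^sub>F l in iter_filter U k. \<exists>a\<in>A. dist (f (u + r *\<^sub>R (\<Sum>n\<leftarrow>l. y n))) a \<le> \<rho>"
    using bounded
  proof eventually_elim
    case (elim l)
    hence "f (u + r *\<^sub>R (\<Sum>n\<leftarrow>l. y n)) \<in> f ` (+) u ` (E \<inter> cball 0 \<tau>)"
      using mem by (intro imageI) simp
    hence "f (u + r *\<^sub>R (\<Sum>n\<leftarrow>l. y n)) \<in> (\<Union>a\<in>A. cball a \<rho>)" using A(2) by blast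
    thus ?case by (simp add: dist_commute)
  qed
  thus ?thesis by (rule ultrafilter_finite_Bex[OF ultrafilter_iter_filter[OF U] A(1)]) (rule that)
qed

definition sums_concentrate ::
  "('a::real_normed_vector \<Rightarrow> 'b::metric_space) \<Rightarrow> nat filter \<Rightarrow> nat \<Rightarrow> 'a \<Rightarrow> real \<Rightarrow> 'a set \<Rightarrow> real \<Rightarrow> bool"
  where
  "sums_concentrate f U k u r E \<rho> \<longleftrightarrow>
     (\<forall>y\<in>weakly_null_unit_seqs U E. \<exists>w. \<forall>\<^sub>F l in iter_filter U k.
        dist (f (u + r *\<^sub>R (\<Sum>n\<leftarrow>l. y n))) w \<le> \<rho>)"

lemma sums_concentrate_mono:
  assumes "sums_concentrate f U k u r E \<rho>" "\<rho> \<le> \<rho>'"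
  shows "sums_concentrate f U k u r E \<rho>'"
  unfolding sums_concentrate_def
proof
  fix y assume "y \<in> weakly_null_unit_seqs U E"
  then obtain w where "\<forall>\<^sub>F l in iter_filter U k. dist (f (u + r *\<^sub>R (\<Sum>n\<leftarrow>l. y n))) w \<le> \<rho>"
    using assms(1) unfolding sums_concentrate_def by blast
  hence "\<forall>\<^sub>F l in iter_filter U k. dist (f (u + r *\<^sub>R (\<Sum>n\<leftarrow>l. y n))) w \<le> \<rho>'"
    by eventually_elim (use assms(2) in simp)
  thus "\<exists>w. \<forall>\<^sub>F l in iter_filter U k. dist (f (u + r *\<^sub>R (\<Sum>n\<leftarrow>l. y n))) w \<le> \<rho>'" by blast
qed

lemma flat_coordinate_sum_concentration:
  fixes f :: "'x::real_normed_vector \<Rightarrow> 'y1::real_normed_vector \<times> 'y2::real_normed_vector"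
  assumes U: "ultrafilter U" and f: "coarse_lipschitz L f"
    and upper_x: "weak_upper_estimate TYPE('x) p C" "0 < p"
    and refl: "reflexive TYPE('y2)" and upper_y2: "weak_upper_estimate TYPE('y2) q D" "0 < q"
    and E: "fin_codim_subspace E"
    and net: "has_finite_net ((\<lambda>x. fst (f x)) ` (+) u ` (E \<inter> cball 0 \<sigma>)) \<rho>"
    and r: "1 \<le> r" "r * (real k * C) powr (1 / p) \<le> \<sigma>"
  shows "sums_concentrate f U k u r E (\<rho> + 3 * L * r * (real k * D) powr (1 / q))"
  unfolding sums_concentrate_def
proof
  fix y assume "y \<in> weakly_null_unit_seqs U E"
  hence y: "\<And>n. y n \<in> E" "\<And>n. norm (y n) \<le> 1" "tendsto_weakly y 0 U"
    by (simp_all add: weakly_null_unit_seqs_def)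
  have "\<forall>\<^sub>F l in iter_filter U k. norm (\<Sum>n\<leftarrow>l. y n) \<le> (real k * C) powr (1 / p)"
    by (rule weak_upper_estimate_sum_list_bound[OF upper_x(1) y(3,2) upper_x(2)])
  hence "\<forall>\<^sub>F l in iter_filter U k. norm (r *\<^sub>R (\<Sum>n\<leftarrow>l. y n)) \<le> \<sigma>"
  proof eventually_elim
    case (elim l)
    hence "r * norm (\<Sum>n\<leftarrow>l. y n) \<le> r * (real k * C) powr (1 / p)"
      using r(1) by (intro mult_left_mono) auto
    also note r(2)
    finally show ?case using r(1) by simp
  qed
  then obtain a where a: "\<forall>\<^sub>F l in iter_filter U k. dist (fst (f (u + r *\<^sub>R (\<Sum>n\<leftarrow>l. y n)))) a \<le> \<rho>"
    by (rule has_finite_net_sum_concentration[OF U E y(1) net]) (rule that)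
  obtain z where z: "\<forall>\<^sub>F l in iter_filter U k.
      dist (snd (f (u + r *\<^sub>R (\<Sum>n\<leftarrow>l. y n)))) z \<le> 3 * L * r * (real k * D) powr (1 / q)"
    by (rule coarse_lipschitz_sum_concentration[OF refl U upper_y2 coarse_lipschitz_snd[OF f] y(2) r(1)])
      (rule that)
  have "\<forall>\<^sub>F l in iter_filter U k.
      dist (f (u + r *\<^sub>R (\<Sum>n\<leftarrow>l. y n))) (a, z) \<le> \<rho> + 3 * L * r * (real k * D) powr (1 / q)"
    using a z
  proof eventually_elim
    case (elim l)
    thus ?case
      using dist_le_dist_fst_plus_dist_snd[of "f (u + r *\<^sub>R (\<Sum>n\<leftarrow>l. y n))" "(a, z)"] by simp
  qed
  thus "\<exists>w. \<forall>\<^sub>F l in iter_filter U k.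
      dist (f (u + r *\<^sub>R (\<Sum>n\<leftarrow>l. y n))) w \<le> \<rho> + 3 * L * r * (real k * D) powr (1 / q)" by blast
qed

lemma negative_powr_small:
  fixes B \<epsilon> \<gamma> :: real
  assumes "\<gamma> < 0" "\<epsilon> > 0"
  obtains k :: nat where "k > 0" "B * real k powr \<gamma> \<le> \<epsilon>"
proof -
  have "((\<lambda>k. real k powr \<gamma>) \<longlongrightarrow> 0) sequentially"
    using assms(1) by (intro tendsto_neg_powr filterlim_real_sequentially)
  hence "((\<lambda>k. B * real k powr \<gamma>) \<longlongrightarrow> 0) sequentially" by (rule tendsto_mult_right_zero)
  hence "\<forall>\<^sub>F k in sequentially. 0 < k \<and> B * real k powr \<gamma> < \<epsilon>"
    using assms(2) by (intro eventually_conj eventually_gt_at_top order_tendstoD(2))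
  then obtain k where "0 < k \<and> B * real k powr \<gamma> < \<epsilon>"
    using eventually_happens'[OF sequentially_bot] by blast
  thus ?thesis by (intro that[of k]) auto
qed

text \<open>The radius \<open>\<tau>\<close> of the ball and the number \<open>k\<close> of summands are balanced so that the sums of \<open>k\<close>
  vectors, scaled by \<open>\<tau> / k powr (1 / p)\<close>, just stay inside the ball where the first coordinate is flat,
  while the second coordinate oscillates by order \<open>\<tau> * k powr (1 / q2 - 1 / p)\<close> only.\<close>

lemma coarse_lipschitz_sums_concentrate_at_scale:
  fixes f :: "'x::real_normed_vector \<Rightarrow> 'y1::real_normed_vector \<times> 'y2::real_normed_vector"
    and e :: "nat \<Rightarrow> 'y1"
  assumes exponents: "1 \<le> q1" "q1 < p" "0 < q2"
    and smooth: "asymptotically_uniformly_smooth_power TYPE('x::real_normed_vector) p"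
    and basis: "schauder_basis e" "lower_estimate_const1 e q1"
    and upper_x: "weak_upper_estimate TYPE('x) p C" and "C > 0"
    and refl: "reflexive TYPE('y2)" and upper_y2: "weak_upper_estimate TYPE('y2) q2 D"
    and f: "coarse_lipschitz L f" and U: "ultrafilter U"
    and \<epsilon>: "\<epsilon> > 0" "3 * L * D powr (1 / q2) * real k powr (1 / q2 - 1 / p) \<le> \<epsilon> / 2"
    and k: "0 < k" and t: "0 \<le> t"
  obtains u \<tau> E where "t < \<tau>" "fin_codim_subspace E"
    "sums_concentrate f U k u (\<tau> / real k powr (1 / p)) E (\<epsilon> * \<tau>)"
proof -
  define a \<kappa> where "a = C powr (1 / p)" and "\<kappa> = real k powr (1 / p)"
  have pos: "a > 0" "\<kappa> > 0" using \<open>C > 0\<close> k by (simp_all add: a_def \<kappa>_def)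
  have "0 < \<epsilon> / (2 * a)" "0 \<le> a * max t \<kappa>" using \<epsilon>(1) pos t by auto
  then obtain u \<sigma> E where \<sigma>: "a * max t \<kappa> < \<sigma>" and E: "fin_codim_subspace E"
    and net: "has_finite_net ((\<lambda>x. fst (f x)) ` (+) u ` (E \<inter> cball 0 \<sigma>)) (\<epsilon> / (2 * a) * \<sigma>)"
    by (rule coarse_lipschitz_flat_on_fin_codim[OF coarse_lipschitz_fst[OF f] smooth basis
          exponents(1,2)]) (rule that)
  define \<tau> r where "\<tau> = \<sigma> / a" and "r = \<tau> / \<kappa>"
  have \<sigma>_eq: "\<sigma> = a * \<tau>" using pos by (simp add: \<tau>_def)
  have "max t \<kappa> < \<tau>" using \<sigma> pos unfolding \<sigma>_eq by (simp only: mult_less_cancel_left_pos)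
  hence \<tau>: "t < \<tau>" "\<kappa> < \<tau>" "0 < \<tau>" using t by auto
  have r: "1 \<le> r" "r * \<kappa> = \<tau>" using \<tau>(2) pos by (simp_all add: r_def)
  have "(real k * C) powr (1 / p) = \<kappa> * a" unfolding \<kappa>_def a_def by (rule powr_mult)
  hence inside: "r * (real k * C) powr (1 / p) \<le> \<sigma>" by (simp add: \<sigma>_eq r(2)[symmetric])
  have "sums_concentrate f U k u r E (\<epsilon> / (2 * a) * \<sigma> + 3 * L * r * (real k * D) powr (1 / q2))"
    using exponents
    by (intro flat_coordinate_sum_concentration[OF U f upper_x _ refl upper_y2 _ E net r(1) inside]) auto
  moreover have "3 * L * r * (real k * D) powr (1 / q2) \<le> \<epsilon> / 2 * \<tau>"
  proof -
    have "(real k * D) powr (1 / q2) = real k powr (1 / q2 - 1 / p) * \<kappa> * D powr (1 / q2)"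
      unfolding powr_mult by (simp add: \<kappa>_def flip: powr_add)
    hence "3 * L * r * (real k * D) powr (1 / q2)
        = 3 * L * D powr (1 / q2) * real k powr (1 / q2 - 1 / p) * \<tau>"
      by (simp add: r(2)[symmetric])
    also have "\<dots> \<le> \<epsilon> / 2 * \<tau>" using \<epsilon>(2) \<tau>(3) by (intro mult_right_mono) auto
    finally show ?thesis .
  qed
  moreover have "\<epsilon> / (2 * a) * \<sigma> = \<epsilon> / 2 * \<tau>" using pos by (simp add: \<sigma>_eq)
  ultimately have "sums_concentrate f U k u r E (\<epsilon> * \<tau>)" by (elim sums_concentrate_mono) simp
  thus ?thesis using \<tau>(1) E unfolding r_def \<kappa>_def by (intro that)
qed

lemma coarse_lipschitz_sums_concentrate:
  fixes f :: "'x::real_normed_vector \<Rightarrow> 'y1::real_normed_vector \<times> 'y2::real_normed_vector"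
    and e :: "nat \<Rightarrow> 'y1"
  assumes exponents: "1 \<le> q1" "q1 < p" "p < q2"
    and smooth_x: "asymptotically_uniformly_smooth_power TYPE('x::real_normed_vector) p"
    and basis: "schauder_basis e" "lower_estimate_const1 e q1"
    and refl: "reflexive TYPE('y2::real_normed_vector)"
    and smooth_y2: "asymptotically_uniformly_smooth_power TYPE('y2::real_normed_vector) q2"
    and f: "coarse_lipschitz L f" and U: "ultrafilter U" and \<epsilon>: "\<epsilon> > 0"
  obtains k where "0 < k"
    "\<And>t. 0 \<le> t \<Longrightarrow> \<exists>u \<tau> E. t < \<tau> \<and> fin_codim_subspace E \<and>
       sums_concentrate f U k u (\<tau> / real k powr (1 / p)) E (\<epsilon> * \<tau>)"
proof -
  obtain C where C: "weak_upper_estimate TYPE('x) p C" "C > 0"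
    using asym_smooth_imp_weak_upper_estimate[OF smooth_x] exponents by auto
  obtain D where D: "weak_upper_estimate TYPE('y2) q2 D"
    using asym_smooth_imp_weak_upper_estimate[OF smooth_y2] exponents by auto
  have "0 < q2" "1 / q2 - 1 / p < 0" "\<epsilon> / 2 > 0" using exponents \<epsilon> by (simp_all add: field_simps)
  obtain k where k: "0 < k" "3 * L * D powr (1 / q2) * real k powr (1 / q2 - 1 / p) \<le> \<epsilon> / 2"
    by (rule negative_powr_small[OF \<open>1 / q2 - 1 / p < 0\<close> \<open>\<epsilon> / 2 > 0\<close>])
  have "\<exists>u \<tau> E. t < \<tau> \<and> fin_codim_subspace E \<and>
      sums_concentrate f U k u (\<tau> / real k powr (1 / p)) E (\<epsilon> * \<tau>)" if "0 \<le> t" for t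
    by (rule coarse_lipschitz_sums_concentrate_at_scale[OF exponents(1,2) \<open>0 < q2\<close> smooth_x basis C refl D
          f U \<epsilon> k(2,1) that]) blast
  thus ?thesis by (rule that[OF k(1)])
qed

lemma spreading_concentration_scale_bound:
  fixes f :: "'a::real_normed_vector \<Rightarrow> 'b::metric_space"
  assumes lower: "\<And>x y. dist x y / L - L \<le> dist (f x) (f y)" and "L > 0"
    and spreading: "uniformly_spreading TYPE('a) U p c" "c > 0" and "U \<noteq> bot"
    and E: "fin_codim_subspace E" and "0 < k" and "0 < \<tau>"
    and conc: "sums_concentrate f U k u (\<tau> / real k powr (1 / p)) E \<rho>"
  shows "\<tau> * c / (2 * L) \<le> 2 * \<rho> + L"
proof -
  define b r where "b = c * real k powr (1 / p)" and "r = \<tau> / real k powr (1 / p)"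
  have pos: "b > 0" "r > 0" and rb: "r * b = \<tau> * c"
    using \<open>c > 0\<close> \<open>0 < k\<close> \<open>0 < \<tau>\<close> by (simp_all add: b_def r_def)
  obtain y where y: "y \<in> weakly_null_unit_seqs U E"
    and spread: "\<forall>\<^sub>F l in iter_filter U k. b \<le> norm (\<Sum>n\<leftarrow>l. y n)"
    using spreading(1) E \<open>0 < k\<close> unfolding uniformly_spreading_def b_def by blast
  obtain w where w: "\<forall>\<^sub>F l in iter_filter U k. dist (f (u + r *\<^sub>R (\<Sum>n\<leftarrow>l. y n))) w \<le> \<rho>"
    using conc y unfolding sums_concentrate_def r_def by blast
  have null: "tendsto_weakly (\<lambda>l. \<Sum>n\<leftarrow>l. y n) 0 (iter_filter U k)"
    using y by (simp add: weakly_null_unit_seqs_def tendsto_weakly_iter_filter_sum_list)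
  obtain i j where close: "dist (f (u + r *\<^sub>R (\<Sum>n\<leftarrow>i. y n))) w \<le> \<rho>"
      "dist (f (u + r *\<^sub>R (\<Sum>n\<leftarrow>j. y n))) w \<le> \<rho>"
    and separated: "b / 2 \<le> norm ((\<Sum>n\<leftarrow>i. y n) - (\<Sum>n\<leftarrow>j. y n))"
    using weakly_null_separated_pair[OF null iter_filter_neq_bot[OF \<open>U \<noteq> bot\<close>] pos(1) spread w]
    by blast
  define x x' where "x = u + r *\<^sub>R (\<Sum>n\<leftarrow>i. y n)" and "x' = u + r *\<^sub>R (\<Sum>n\<leftarrow>j. y n)"
  have "r * (b / 2) \<le> r * norm ((\<Sum>n\<leftarrow>i. y n) - (\<Sum>n\<leftarrow>j. y n))" using separated pos(2) by simp
  also have "\<dots> = dist x x'"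
    using pos(2) by (simp add: x_def x'_def dist_norm flip: scaleR_right_diff_distrib)
  finally have "r * (b / 2) / L \<le> dist x x' / L"
    using \<open>L > 0\<close> by (rule divide_right_mono[OF _ less_imp_le])
  also have "\<dots> \<le> dist (f x) (f x') + L" using lower[of x x'] by simp
  also have "\<dots> \<le> \<rho> + \<rho> + L"
    using close dist_triangle2[of "f x" "f x'" w] unfolding x_def x'_def by linarith
  finally show ?thesis using rb by simp
qed

theorem theorem5p6:
  fixes q1 p q2 :: real
    and e :: "nat \<Rightarrow> 'y1::banach"
  assumes "1 \<le> q1" and "q1 < p" and "p < q2"
    and "infinite_dimensional TYPE('x::banach)"
    and "asymptotically_uniformly_smooth_power TYPE('x) p"
    and "co_banach_saks TYPE('x) p"
    and "\<not> contains_l1 TYPE('x)"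
    and "one_unconditional_basis e"
    and "lower_estimate_const1 e q1"
    and "reflexive TYPE('y2::banach)"
    and "asymptotically_uniformly_smooth_power TYPE('y2) q2"
  shows "\<not> (\<exists>f :: 'x \<Rightarrow> 'y1 \<times> 'y2. coarse_lipschitz_embedding f)"
proof
  assume "\<exists>f :: 'x \<Rightarrow> 'y1 \<times> 'y2. coarse_lipschitz_embedding f"
  then obtain f :: "'x \<Rightarrow> 'y1 \<times> 'y2" and L where f: "coarse_lipschitz L f"
    and lower: "\<And>x y. dist x y / L - L \<le> dist (f x) (f y)"
    by (metis coarse_lipschitz_embeddingE)
  have L: "L > 0" using f by (simp add: coarse_lipschitz_def)
  have p: "p > 1" and e: "schauder_basis e"
    using assms(1,2,8) by (simp_all add: one_unconditional_basis_def)
  obtain U :: "nat filter" where U: "ultrafilter U" "U \<le> sequentially"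
    using ultrafilter_below_exists[OF sequentially_bot] by blast
  obtain c where c: "c > 0" "uniformly_spreading TYPE('x) U p c"
    using co_banach_saks_imp_uniformly_spreading[OF assms(4,5) p assms(6) U(2)] by blast
  have "c / (8 * L) > 0" and t: "0 \<le> 4 * L * L / c" using c L by simp_all
  then obtain k where k: "0 < k" and conc: "\<And>t. 0 \<le> t \<Longrightarrow> \<exists>u \<tau> E. t < \<tau> \<and> fin_codim_subspace E \<and>
      sums_concentrate f U k u (\<tau> / real k powr (1 / p)) E (c / (8 * L) * \<tau>)"
    using coarse_lipschitz_sums_concentrate[OF assms(1-3,5) e assms(9-11) f U(1)] by blast
  obtain u \<tau> E where \<tau>: "4 * L * L / c < \<tau>" and E: "fin_codim_subspace E"
    and conc_\<tau>: "sums_concentrate f U k u (\<tau> / real k powr (1 / p)) E (c / (8 * L) * \<tau>)"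
    using conc[OF t] by blast
  have "U \<noteq> bot" "0 < \<tau>" using U(1) \<tau> t by (auto simp: ultrafilter_def)
  hence "\<tau> * c / (2 * L) \<le> 2 * (c / (8 * L) * \<tau>) + L"
    by (rule spreading_concentration_scale_bound[OF lower L c(2,1) _ E k _ conc_\<tau>])
  hence "\<tau> * c \<le> 4 * L * L" using L by (simp add: field_simps)
  thus False using \<tau> c(1) by (simp add: field_simps)
qed

end
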